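(* Let $n\ge 2$, weights $w_1,\dots,w_n>0$, $\Delta=\max_i w_i$, $\eta>0$ and $\delta\in(0,1/2]$. Let $c:\mathbb R_+\to\mathbb R^n_+$ be a piecewise continuous cost path and let $x:\mathbb R_+\to\mathsf K$ be the entropic mirror descent path defined below. Let $y:\mathbb R_+\to\mathsf K$ be any absolutely continuous path with $y(0)=x(0)$ and set $S^*=\int_{\mathbb R_+}\langle c(t),y(t)\rangle dt$, $M^*=\int_{\mathbb R_+}\|y'(t)\|dt$ (assumed finite). Then, with $S=\int_{\mathbb R_+}\langle c(t),x(t)\rangle dt$ and $M=\int_{\mathbb R_+}\|x'(t)\|dt$, \[ S\le S^*+\frac{2\log(1/\delta)}{\eta}M^*,\qquad M\le 2\eta(1+\delta n)S+\big(1+8\delta n\log(1/\delta)\big)\Delta. \] In particular, for $\eta=4\log n$ and $\delta=1/n^2$, one has $S\le S^*+M^*$ and $M\le K\log n\,(S^*+M^*+\Delta)$ for a universal constant $K$.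
   Context: $\mathsf K=\{x\in\mathbb R^n_+:\sum_i x_i=1\}$ (probability vectors on the leaves of a star whose $i$-th leaf is joined to the center by an edge of weight $w_i$), with norm $\|z\|=\sum_{i=1}^n w_i|z_i|$. The regularizer is $\Phi(x)=\frac1\eta\sum_{i=1}^n w_i(x_i+\delta)\log(x_i+\delta)$. The entropic mirror descent path is an absolutely continuous $x:\mathbb R_+\to\mathsf K$ with given $x(0)$, together with measurable $\mu:\mathbb R_+\to\mathbb R$ and $\xi:\mathbb R_+\to\mathbb R^n_+$ satisfying $\xi_i(t)>0\Rightarrow x_i(t)=0$, such that for almost every $t$ and all $i$: $x_i'(t)=\frac{\eta}{w_i}(x_i(t)+\delta)\big(\mu(t)-c_i(t)+\xi_i(t)\big)$. *)

theory Defs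
  imports "HOL-Analysis.Analysis"
begin

text \<open>Vectors in R^n are represented as functions nat => real; only the
  coordinates i < n are meaningful.\<close>

definition in_simplex :: "nat \<Rightarrow> (nat \<Rightarrow> real) \<Rightarrow> bool" where
  "in_simplex n z \<longleftrightarrow> (\<forall>i<n. 0 \<le> z i) \<and> (\<Sum>i<n. z i) = 1"

definition wnorm :: "nat \<Rightarrow> (nat \<Rightarrow> real) \<Rightarrow> (nat \<Rightarrow> real) \<Rightarrow> real" where
  "wnorm n w z = (\<Sum>i<n. w i * \<bar>z i\<bar>)"

definition abs_cont_on :: "real set \<Rightarrow> (real \<Rightarrow> real) \<Rightarrow> bool" where
  "abs_cont_on S f \<longleftrightarrow>
     (\<forall>e>0. \<exists>d>0. \<forall>P :: (real \<times> real) set.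
        finite P \<and> (\<forall>(a,b)\<in>P. a \<le> b \<and> {a..b} \<subseteq> S)
        \<and> disjoint_family_on (\<lambda>p. {fst p<..<snd p}) P
        \<and> (\<Sum>(a,b)\<in>P. b - a) < d
        \<longrightarrow> (\<Sum>(a,b)\<in>P. \<bar>f b - f a\<bar>) < e)"

definition abs_cont_path :: "nat \<Rightarrow> (real \<Rightarrow> nat \<Rightarrow> real) \<Rightarrow> bool" where
  "abs_cont_path n p \<longleftrightarrow> (\<forall>i<n. \<forall>T. abs_cont_on {0..T} (\<lambda>t. p t i))"

definition piecewise_cont_path :: "nat \<Rightarrow> (real \<Rightarrow> nat \<Rightarrow> real) \<Rightarrow> bool" where
  "piecewise_cont_path n c \<longleftrightarrow>
     (\<forall>T. \<exists>D. finite D \<and> (\<forall>i<n.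
        continuous_on ({0..T} - D) (\<lambda>t. c t i)
        \<and> (\<forall>d\<in>D. \<exists>l. ((\<lambda>t. c t i) \<longlongrightarrow> l) (at_right d))
        \<and> (\<forall>d\<in>D. 0 < d \<longrightarrow> (\<exists>l. ((\<lambda>t. c t i) \<longlongrightarrow> l) (at_left d)))))"

definition emd_path :: "nat \<Rightarrow> (nat \<Rightarrow> real) \<Rightarrow> real \<Rightarrow> real \<Rightarrow> (real \<Rightarrow> nat \<Rightarrow> real)
    \<Rightarrow> (real \<Rightarrow> nat \<Rightarrow> real) \<Rightarrow> bool" where
  "emd_path n w \<eta> \<delta> c x \<longleftrightarrow>
     abs_cont_path n x \<and> (\<forall>t\<ge>0. in_simplex n (x t)) \<and>
     (\<exists>\<mu> \<xi>. \<mu> \<in> borel_measurable (restrict_space lborel {0..})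
        \<and> (\<forall>i<n. (\<lambda>t. \<xi> t i) \<in> borel_measurable (restrict_space lborel {0..}))
        \<and> (\<forall>t\<ge>0. \<forall>i<n. 0 \<le> \<xi> t i \<and> (0 < \<xi> t i \<longrightarrow> x t i = 0))
        \<and> (AE t in lborel. 0 \<le> t \<longrightarrow> (\<forall>i<n.
             ((\<lambda>s. x s i) has_real_derivative
                (\<eta> / w i * (x t i + \<delta>) * (\<mu> t - c t i + \<xi> t i))) (at t within {0..}))))"

definition service_cost :: "nat \<Rightarrow> (real \<Rightarrow> nat \<Rightarrow> real) \<Rightarrow> (real \<Rightarrow> nat \<Rightarrow> real) \<Rightarrow> ennreal" where
  "service_cost n c p = (\<integral>\<^sup>+ t. ennreal (\<Sum>i<n. c t i * p t i) * indicator {0..} t \<partial>lborel)"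

definition movement_cost :: "nat \<Rightarrow> (nat \<Rightarrow> real) \<Rightarrow> (real \<Rightarrow> nat \<Rightarrow> real) \<Rightarrow> ennreal" where
  "movement_cost n w p =
     (\<integral>\<^sup>+ t. ennreal (wnorm n w (\<lambda>i. deriv (\<lambda>s. p s i) t)) * indicator {0..} t \<partial>lborel)"

definition setting :: "nat \<Rightarrow> (nat \<Rightarrow> real) \<Rightarrow> real \<Rightarrow> real \<Rightarrow> (real \<Rightarrow> nat \<Rightarrow> real)
    \<Rightarrow> (real \<Rightarrow> nat \<Rightarrow> real) \<Rightarrow> (real \<Rightarrow> nat \<Rightarrow> real) \<Rightarrow> bool" where
  "setting n w \<eta> \<delta> c x y \<longleftrightarrow>
     2 \<le> n \<and> (\<forall>i<n. 0 < w i) \<and> 0 < \<eta> \<and> 0 < \<delta> \<and> \<delta> \<le> 1/2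
     \<and> (\<forall>t\<ge>0. \<forall>i<n. 0 \<le> c t i) \<and> piecewise_cont_path n c
     \<and> emd_path n w \<eta> \<delta> c x
     \<and> abs_cont_path n y \<and> (\<forall>t\<ge>0. in_simplex n (y t)) \<and> (\<forall>i<n. y 0 i = x 0 i)
     \<and> service_cost n c y < \<infinity> \<and> movement_cost n w y < \<infinity>"

end

theory Submission
  imports Defs
begin

text \<open>
  For the first bound, let D(y, x) be the Bregman divergence of the regularizer. Along the path, the
  \<open>x\<close>-part of its derivative is at most \<open>\<langle>c, y\<rangle> - \<langle>c, x\<rangle>\<close>: the multiplier \<open>\<mu>\<close> cancels because \<open>x\<close> and
  \<open>y\<close> have equal mass, and \<open>\<xi>\<close> contributes with the right sign. The \<open>y\<close>-part is at most
  \<open>2 log(1/\<delta>)/\<eta> * \<parallel>y'\<parallel>\<close>. Integrating from \<open>D = 0\<close> to \<open>D \<ge> 0\<close> gives the bound.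

  For the second bound, the derivative of a nonnegative coordinate vanishes where the coordinate does,
  so only the support of \<open>x\<close> moves, where \<open>\<xi> = 0\<close>; summing the equation shows that \<open>\<mu>\<close> is a weighted
  average of costs, hence \<open>\<mu> \<ge> 0\<close>. So mass leaves \<open>i\<close> at rate at most \<open>\<eta> (x_i + \<delta>) c_i / w_i\<close>, and
  the potentials \<open>W = \<Sum> w_i x_i\<close> and \<open>L = \<Sum> w_i log(x_i + \<delta>)\<close> satisfy \<open>(W - \<delta> L)' = \<eta> (\<mu> - \<langle>c, x\<rangle>)\<close>
  and \<open>L' = \<eta> \<Sum> (\<mu> - c_i)\<close>, the sum being over the support. Hence \<open>\<parallel>x'\<parallel>\<close> is at most
  \<open>2 \<eta> (1 + \<delta> n) \<langle>c, x\<rangle>\<close> plus the derivative of \<open>(1 + 2 \<delta> n) W - 2 \<delta> (1 + \<delta> n) L\<close>, which is bounded on the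
  simplex.

  Both arguments need absolutely continuous functions to be differentiable almost everywhere and to
  be the integrals of their derivatives. Differentiability is essential for \<open>y\<close>, since \<open>deriv\<close> is
  unspecified at the other points.
\<close>

section \<open>Absolutely continuous functions\<close>

text \<open>Divisions are the common language of the gauge integral and of the Vitali families
  below. An interval \<open>K\<close> corresponds to the pair \<open>(Inf K, Sup K)\<close>, and the
  total length in the definition becomes the measure of the union.\<close>

lemma abs_cont_on_divisionE:
  assumes "abs_cont_on S f" "e > 0"
  obtains d where "d > 0"
    "\<And>\<D>. \<lbrakk>\<D> division_of \<Union>\<D>; \<Union>\<D> \<subseteq> S; measure lebesgue (\<Union>\<D>) < d\<rbrakk>
      \<Longrightarrow> (\<Sum>K\<in>\<D>. \<bar>f (Sup K) - f (Inf K)\<bar>) < e"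
proof -
  obtain d where d: "d > 0" and AC: "\<And>P :: (real \<times> real) set.
        finite P \<Longrightarrow> (\<forall>(a,b)\<in>P. a \<le> b \<and> {a..b} \<subseteq> S)
        \<Longrightarrow> disjoint_family_on (\<lambda>p. {fst p<..<snd p}) P
        \<Longrightarrow> (\<Sum>(a,b)\<in>P. b - a) < d
        \<Longrightarrow> (\<Sum>(a,b)\<in>P. \<bar>f b - f a\<bar>) < e"
    using assms unfolding abs_cont_on_def by meson
  show thesis
  proof (rule that[OF d])
    fix \<D> assume D: "\<D> division_of \<Union>\<D>" "\<Union>\<D> \<subseteq> S" "measure lebesgue (\<Union>\<D>) < d"
    define g where "g = (\<lambda>K::real set. (Inf K, Sup K))"
    have K: "\<exists>a b. a \<le> b \<and> K = {a..b} \<and> Inf K = a \<and> Sup K = b" if "K \<in> \<D>" for K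
      using division_ofD(3,4)[OF D(1) that] by fastforce
    have inj: "inj_on g \<D>"
      unfolding g_def inj_on_def using K by (metis prod.inject)
    have "(\<Sum>(a,b)\<in>g ` \<D>. \<bar>f b - f a\<bar>) < e"
    proof (rule AC)
      show "finite (g ` \<D>)" using D(1) by blast
      show "\<forall>(a,b)\<in>g ` \<D>. a \<le> b \<and> {a..b} \<subseteq> S"
      proof safe
        fix a b K assume "(a,b) = g K" "K \<in> \<D>"
        then have "a \<le> b" "{a..b} = K" "K \<subseteq> S"
          using K[of K] D(2) unfolding g_def by (metis Pair_inject, metis Pair_inject, blast)
        then show "a \<le> b" "\<And>x. x \<in> {a..b} \<Longrightarrow> x \<in> S" by auto
      qed
      show "disjoint_family_on (\<lambda>p. {fst p<..<snd p}) (g ` \<D>)"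
        unfolding disjoint_family_on_def
      proof (intro ballI impI)
        fix m m' assume "m \<in> g ` \<D>" "m' \<in> g ` \<D>" "m \<noteq> m'"
        then obtain K K' where *: "K \<in> \<D>" "K' \<in> \<D>" and m: "m = g K" "m' = g K'" "K \<noteq> K'"
          by blast
        then have "interior K \<inter> interior K' = {}" using division_ofD(5)[OF D(1)] by blast
        moreover have "interior K = {Inf K<..<Sup K}" "interior K' = {Inf K'<..<Sup K'}"
          using K[OF *(1)] K[OF *(2)] interior_atLeastAtMost_real by metis+
        ultimately show "{fst m<..<snd m} \<inter> {fst m'<..<snd m'} = {}"
          unfolding m g_def by simp
      qed
      have "(\<Sum>(a,b)\<in>g ` \<D>. b - a) = (\<Sum>K\<in>\<D>. measure lebesgue K)"
        unfolding sum.reindex[OF inj]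
      proof (rule sum.cong)
        fix K assume "K \<in> \<D>"
        then obtain a b where "a \<le> b" "K = {a..b}" using K by blast
        then show "((\<lambda>(a,b). b - a) \<circ> g) K = measure lebesgue K" by (simp add: g_def)
      qed simp
      also have "\<dots> = measure lebesgue (\<Union>\<D>)" by (rule content_division[OF D(1)])
      finally have "(\<Sum>(a,b)\<in>g ` \<D>. b - a) = measure lebesgue (\<Union>\<D>)" .
      with D(3) show "(\<Sum>(a,b)\<in>g ` \<D>. b - a) < d" by simp
    qed
    then show "(\<Sum>K\<in>\<D>. \<bar>f (Sup K) - f (Inf K)\<bar>) < e"
      unfolding sum.reindex[OF inj] by (simp add: g_def)
  qed
qed

lemma abs_cont_on_imp_continuous_on:
  assumes "abs_cont_on {a..b} f"
  shows "continuous_on {a..b} f"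
  unfolding continuous_on_iff
proof safe
  fix x e :: real assume x: "x \<in> {a..b}" and e: "e > 0"
  obtain d where d: "d > 0" and AC: "\<And>P :: (real \<times> real) set.
        finite P \<Longrightarrow> (\<forall>(u,v)\<in>P. u \<le> v \<and> {u..v} \<subseteq> {a..b})
        \<Longrightarrow> disjoint_family_on (\<lambda>p. {fst p<..<snd p}) P
        \<Longrightarrow> (\<Sum>(a,b)\<in>P. b - a) < d
        \<Longrightarrow> (\<Sum>(a,b)\<in>P. \<bar>f b - f a\<bar>) < e"
    using assms e unfolding abs_cont_on_def by meson
  have "dist (f y) (f x) < e" if y: "y \<in> {a..b}" "dist y x < d" for y
    using AC[of "{(min x y, max x y)}"] x y
    by (auto simp: disjoint_family_on_def dist_real_def min_def max_def abs_if split: if_splits)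
  then show "\<exists>d>0. \<forall>x'\<in>{a..b}. dist x' x < d \<longrightarrow> dist (f x') (f x) < e"
    using d by blast
qed

section \<open>Closure properties of absolute continuity\<close>

text \<open>Increments controlled by those of \<open>f\<close> and \<open>g\<close> inherit their
  smallness. Two dominating functions are what sums and products require; unary operations use the
  same function twice.\<close>

lemma abs_cont_on_dominated:
  assumes f: "abs_cont_on S f" and g: "abs_cont_on S g" and C: "C \<ge> 0"
    and le: "\<And>u v. u \<in> S \<Longrightarrow> v \<in> S \<Longrightarrow> \<bar>h v - h u\<bar> \<le> C * (\<bar>f v - f u\<bar> + \<bar>g v - g u\<bar>)"
  shows "abs_cont_on S h"
  unfolding abs_cont_on_def
proof (intro allI impI)
  fix e :: real assume e: "e > 0"
  \<comment> \<open>The denominator \<open>C + 1\<close> also covers \<open>C = 0\<close> and makes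
    the last estimate strict, since \<open>C / (C + 1) < 1\<close>.\<close>
  define e' where "e' = e / (C + 1) / 2"
  have e': "e' > 0" using e C by (simp add: e'_def)
  obtain d1 where d1: "d1 > 0" and A1: "\<And>P :: (real \<times> real) set.
        finite P \<and> (\<forall>(u,v)\<in>P. u \<le> v \<and> {u..v} \<subseteq> S)
        \<and> disjoint_family_on (\<lambda>p. {fst p<..<snd p}) P
        \<and> (\<Sum>(a,b)\<in>P. b - a) < d1
        \<Longrightarrow> (\<Sum>(a,b)\<in>P. \<bar>f b - f a\<bar>) < e'"
    using f e' unfolding abs_cont_on_def by meson
  obtain d2 where d2: "d2 > 0" and A2: "\<And>P :: (real \<times> real) set.
        finite P \<and> (\<forall>(u,v)\<in>P. u \<le> v \<and> {u..v} \<subseteq> S)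
        \<and> disjoint_family_on (\<lambda>p. {fst p<..<snd p}) P
        \<and> (\<Sum>(a,b)\<in>P. b - a) < d2
        \<Longrightarrow> (\<Sum>(a,b)\<in>P. \<bar>g b - g a\<bar>) < e'"
    using g e' unfolding abs_cont_on_def by meson
  show "\<exists>d>0. \<forall>P. finite P \<and> (\<forall>(u,v)\<in>P. u \<le> v \<and> {u..v} \<subseteq> S)
        \<and> disjoint_family_on (\<lambda>p. {fst p<..<snd p}) P
        \<and> (\<Sum>(a,b)\<in>P. b - a) < d \<longrightarrow> (\<Sum>(a,b)\<in>P. \<bar>h b - h a\<bar>) < e"
  proof (intro exI[of _ "min d1 d2"] conjI allI impI)
    show "min d1 d2 > 0" using d1 d2 by simp
    fix P :: "(real \<times> real) set"
    assume P: "finite P \<and> (\<forall>(u,v)\<in>P. u \<le> v \<and> {u..v} \<subseteq> S)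
        \<and> disjoint_family_on (\<lambda>p. {fst p<..<snd p}) P
        \<and> (\<Sum>(a,b)\<in>P. b - a) < min d1 d2"
    have "(\<Sum>(a,b)\<in>P. \<bar>h b - h a\<bar>) \<le> (\<Sum>(a,b)\<in>P. C * (\<bar>f b - f a\<bar> + \<bar>g b - g a\<bar>))"
    proof (rule sum_mono)
      fix p assume "p \<in> P"
      then have "fst p \<le> snd p" "{fst p..snd p} \<subseteq> S" using P by (auto simp: split_def)
      then have "fst p \<in> S" "snd p \<in> S" by auto
      then show "(case p of (a,b) \<Rightarrow> \<bar>h b - h a\<bar>) \<le> (case p of (a,b) \<Rightarrow> C * (\<bar>f b - f a\<bar> + \<bar>g b - g a\<bar>))"
        by (simp add: split_def le)
    qed
    also have "\<dots> = C * ((\<Sum>(a,b)\<in>P. \<bar>f b - f a\<bar>) + (\<Sum>(a,b)\<in>P. \<bar>g b - g a\<bar>))"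
      by (simp add: sum_distrib_left sum.distrib split_def distrib_left)
    also have "\<dots> \<le> C * (e' + e')"
      using A1[of P] A2[of P] P C by (intro mult_left_mono) auto
    also have "\<dots> = e * (C / (C + 1))"
      unfolding e'_def field_sum_of_halves by simp
    also have "\<dots> < e * 1"
      using e C by (intro mult_strict_left_mono) auto
    also have "\<dots> = e" by simp
    finally show "(\<Sum>(a,b)\<in>P. \<bar>h b - h a\<bar>) < e" .
  qed
qed

lemma abs_cont_on_const: "abs_cont_on S (\<lambda>_. k)"
  unfolding abs_cont_on_def by (auto intro!: exI[of _ 1])

lemma abs_cont_on_add:
  assumes "abs_cont_on S f" "abs_cont_on S g"
  shows "abs_cont_on S (\<lambda>t. f t + g t)"
  by (rule abs_cont_on_dominated[OF assms, of 1]) auto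

lemma abs_cont_on_cmult:
  assumes "abs_cont_on S f"
  shows "abs_cont_on S (\<lambda>t. k * f t)"
  by (rule abs_cont_on_dominated[OF assms assms, of "\<bar>k\<bar>"])
    (auto simp flip: right_diff_distrib simp: abs_mult intro!: mult_left_mono)

lemma abs_cont_on_diff:
  assumes "abs_cont_on S f" "abs_cont_on S g"
  shows "abs_cont_on S (\<lambda>t. f t - g t)"
  by (rule abs_cont_on_dominated[OF assms, of 1]) auto

lemma abs_cont_on_sum:
  assumes "\<And>i. i \<in> I \<Longrightarrow> abs_cont_on S (f i)"
  shows "abs_cont_on S (\<lambda>t. \<Sum>i\<in>I. f i t)"
  using assms
  by (induction I rule: infinite_finite_induct) (auto intro: abs_cont_on_const abs_cont_on_add)

lemma abs_cont_on_mult: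
  assumes fg: "abs_cont_on S f" "abs_cont_on S g"
    and B: "\<And>t. t \<in> S \<Longrightarrow> \<bar>f t\<bar> \<le> B" "\<And>t. t \<in> S \<Longrightarrow> \<bar>g t\<bar> \<le> B"
  shows "abs_cont_on S (\<lambda>t. f t * g t)"
proof (rule abs_cont_on_dominated[OF fg, of "\<bar>B\<bar>"])
  fix u v assume uv: "u \<in> S" "v \<in> S"
  have "\<bar>f v * g v - f u * g u\<bar> = \<bar>g v * (f v - f u) + f u * (g v - g u)\<bar>"
    by (simp add: algebra_simps)
  also have "\<dots> \<le> \<bar>g v\<bar> * \<bar>f v - f u\<bar> + \<bar>f u\<bar> * \<bar>g v - g u\<bar>"
    by (metis abs_mult abs_triangle_ineq)
  also have "\<dots> \<le> \<bar>B\<bar> * \<bar>f v - f u\<bar> + \<bar>B\<bar> * \<bar>g v - g u\<bar>"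
    using B uv by (intro add_mono mult_right_mono) (force intro: order_trans)+
  finally show "\<bar>f v * g v - f u * g u\<bar> \<le> \<bar>B\<bar> * (\<bar>f v - f u\<bar> + \<bar>g v - g u\<bar>)"
    by (simp add: algebra_simps)
qed auto

text \<open>The shift keeps the argument at least \<delta>, where the logarithm is Lipschitz with
  constant \<open>1/\<delta>\<close>.\<close>

lemma abs_cont_on_ln_shift:
  fixes \<delta> :: real
  assumes f: "abs_cont_on S f" and "\<delta> > 0" and pos: "\<And>t. t \<in> S \<Longrightarrow> 0 \<le> f t"
  shows "abs_cont_on S (\<lambda>t. ln (f t + \<delta>))"
proof (rule abs_cont_on_dominated[OF f f, of "1/\<delta>"])
  have *: "ln b - ln a \<le> \<bar>b - a\<bar> / \<delta>" if "a \<ge> \<delta>" "b \<ge> \<delta>" for a b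
  proof -
    have "ln b - ln a = ln (b / a)" using that \<open>\<delta> > 0\<close> by (simp add: ln_div)
    also have "\<dots> \<le> b / a - 1" using that \<open>\<delta> > 0\<close> by (intro ln_le_minus_one) auto
    also have "\<dots> = (b - a) / a" using that \<open>\<delta> > 0\<close> by (simp add: field_simps)
    also have "\<dots> \<le> \<bar>b - a\<bar> / a" using that \<open>\<delta> > 0\<close> by (intro divide_right_mono) auto
    also have "\<dots> \<le> \<bar>b - a\<bar> / \<delta>" using that \<open>\<delta> > 0\<close> by (intro divide_left_mono) auto
    finally show ?thesis .
  qed
  fix u v assume "u \<in> S" "v \<in> S"
  then have "\<bar>ln (f v + \<delta>) - ln (f u + \<delta>)\<bar> \<le> \<bar>f v - f u\<bar> / \<delta>"
    using *[of "f u + \<delta>" "f v + \<delta>"] *[of "f v + \<delta>" "f u + \<delta>"] pos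
    by (auto simp: abs_le_iff abs_minus_commute)
  also have "\<dots> \<le> 1/\<delta> * (\<bar>f v - f u\<bar> + \<bar>f v - f u\<bar>)"
    using \<open>\<delta> > 0\<close> by (simp add: field_simps)
  finally show "\<bar>ln (f v + \<delta>) - ln (f u + \<delta>)\<bar> \<le> 1/\<delta> * (\<bar>f v - f u\<bar> + \<bar>f v - f u\<bar>)" .
qed (use \<open>\<delta> > 0\<close> in auto)

section \<open>The fundamental theorem of calculus for absolutely continuous functions\<close>

text \<open>Outer regularity makes \<open>U - N\<close> small, and removing the null set
  \<open>N\<close> does not change the measure of \<open>U\<close>.\<close>

lemma negligible_open_cover:
  assumes "negligible N" "d > 0"
  obtains U where "open U" "N \<subseteq> U" "U \<in> lmeasurable" "measure lebesgue U < d"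
proof -
  have N: "N \<in> null_sets lebesgue" using assms(1) by (simp add: negligible_iff_null_sets)
  then obtain U where U: "open U" "N \<subseteq> U" "U - N \<in> lmeasurable" "emeasure lebesgue (U - N) < ennreal d"
    using sets_lebesgue_outer_open[of N d] assms(2) by (metis null_setsD2)
  have em: "emeasure lebesgue (U - N) = emeasure lebesgue U"
    using N U(1) by (intro emeasure_Diff_null_set) auto
  then have "U \<in> lmeasurable"
    using U em by (intro fmeasurableI) (auto intro: order.strict_trans[OF _ ennreal_less_top])
  moreover have "measure lebesgue U < d"
    using U(4) em assms(2) \<open>U \<in> lmeasurable\<close> by (simp add: emeasure_eq_measure2 ennreal_less_iff)
  ultimately show thesis using that U by blast
qed

text \<open>At a point of differentiability the gauge makes the Riemann term agree with the
  increment of \<open>f\<close> up to \<epsilon> times the length. Intervals tagged in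
  \<open>N\<close> are confined to an open set of small measure, where absolute continuity bounds
  the sum of the increments.\<close>

lemma abs_cont_on_has_integral_derivative:
  assumes ab: "a \<le> b" and AC: "abs_cont_on {a..b} f" and N: "negligible N"
    and der: "\<And>t. t \<in> {a..b} - N \<Longrightarrow> (f has_real_derivative f' t) (at t within {a..b})"
  shows "(f' has_integral (f b - f a)) {a..b}"
proof -
  \<comment> \<open>With value 0 on \<open>N\<close>, tags in \<open>N\<close> add nothing to the
    Riemann sum, and only the increments of \<open>f\<close> remain there.\<close>
  define g where "g t = (if t \<in> N then 0 else f' t)" for t
  have "(g has_integral (f b - f a)) {a..b}"
    unfolding has_integral_real
  proof safe
    fix e :: real assume e: "e > 0"
    \<comment> \<open>Half of \<open>e\<close> is reserved for the tags in \<open>N\<close>; the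
      summand 1 keeps the denominator positive when \<open>a = b\<close>.\<close>
    define \<epsilon> where "\<epsilon> = e / (2 * (b - a + 1))"
    have \<epsilon>: "\<epsilon> > 0" "\<epsilon> * (b - a) < e / 2"
      using e ab by (auto simp: \<epsilon>_def field_simps)
    obtain d where d: "d > 0" and small: "\<And>\<D>. \<lbrakk>\<D> division_of \<Union>\<D>; \<Union>\<D> \<subseteq> {a..b}; measure lebesgue (\<Union>\<D>) < d\<rbrakk>
      \<Longrightarrow> (\<Sum>K\<in>\<D>. \<bar>f (Sup K) - f (Inf K)\<bar>) < e/2"
      using abs_cont_on_divisionE[OF AC half_gt_zero[OF e]] by blast
    obtain U where U: "open U" "N \<subseteq> U" "U \<in> lmeasurable" "measure lebesgue U < d"
      using negligible_open_cover[OF N d] by blast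
    have "\<exists>r>0. t \<in> {a..b} - N \<longrightarrow>
         (\<forall>y\<in>{a..b}. \<bar>y - t\<bar> < r \<longrightarrow> \<bar>f y - f t - (y - t) * f' t\<bar> \<le> \<epsilon> * \<bar>y - t\<bar>)" for t
    proof (cases "t \<in> {a..b} - N")
      case True
      then show ?thesis
        using der[OF True] \<epsilon>(1)
        unfolding has_field_derivative_def has_derivative_within_alt
        by (metis real_norm_def mult.commute)
    qed (auto intro: exI[of _ 1])
    then obtain r where r: "\<And>t. r t > 0"
      "\<And>t y. \<lbrakk>t \<in> {a..b} - N; y \<in> {a..b}; \<bar>y - t\<bar> < r t\<rbrakk> \<Longrightarrow> \<bar>f y - f t - (y - t) * f' t\<bar> \<le> \<epsilon> * \<bar>y - t\<bar>"
      by metis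
    define \<gamma> where "\<gamma> t = (if t \<in> N then U else ball t (r t))" for t
    show "\<exists>\<gamma>. gauge \<gamma> \<and> (\<forall>\<D>. \<D> tagged_division_of {a..b} \<and> \<gamma> fine \<D> \<longrightarrow>
        norm ((\<Sum>(x,k)\<in>\<D>. measure lborel k *\<^sub>R g x) - (f b - f a)) < e)"
    proof (intro exI[of _ \<gamma>] conjI allI impI)
      show "gauge \<gamma>"
        using U(1,2) r(1) by (auto simp: gauge_def \<gamma>_def)
    next
      fix p assume "p tagged_division_of {a..b} \<and> \<gamma> fine p"
      then have p: "p tagged_division_of {a..b}" and fine: "\<gamma> fine p" by auto
      define q where "q = {z \<in> p. fst z \<in> N}"
      have finp: "finite p" and qp: "q \<subseteq> p" using p by (auto simp: q_def)
      have K: "\<exists>u v. u \<le> v \<and> K = {u..v} \<and> x \<in> {u..v} \<and> {u..v} \<subseteq> {a..b}" if "(x,K) \<in> p" for x K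
        using tagged_division_ofD(2,3,4)[OF p that] by fastforce
      have q: "q tagged_partial_division_of {a..b}"
        using p qp unfolding tagged_division_of_def
        by (metis tagged_partial_division_subset)
      have D: "snd ` q division_of \<Union>(snd ` q)"
        by (rule partial_division_of_tagged_division[OF q])
      have sub: "\<Union>(snd ` q) \<subseteq> U"
        using fine by (fastforce simp: fine_def q_def \<gamma>_def)
      have "measure lebesgue (\<Union>(snd ` q)) \<le> measure lebesgue U"
        using sub U(3) lmeasurable_division[OF D] by (intro measure_mono_fmeasurable) auto
      then have sm: "(\<Sum>K\<in>snd ` q. \<bar>f (Sup K) - f (Inf K)\<bar>) < e/2"
        using U(4) K by (intro small[OF D]) (fastforce simp: q_def)+
      \<comment> \<open>Two tags can share an interval only if it is degenerate, so passing from
        tagged intervals to intervals loses only zero terms. The guard makes the term vanish on the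
        empty interval too, where \<open>Inf\<close> and \<open>Sup\<close> are unspecified.\<close>
      let ?h = "\<lambda>K. if K = {} then 0 else \<bar>f (Sup K) - f (Inf K)\<bar>"
      have "(\<Sum>(x,K)\<in>q. ?h K) = (\<Sum>K\<in>snd ` q. ?h K)"
      proof (rule sum.over_tagged_division_lemma[OF tagged_partial_division_of_Union_self[OF q]])
        fix u v :: real assume "box u v = {}"
        then show "?h (cbox u v) = 0"
          by (cases "u = v") auto
      qed
      moreover have "(\<Sum>(x,K)\<in>q. ?h K) = (\<Sum>(x,K)\<in>q. \<bar>f (Sup K) - f (Inf K)\<bar>)"
        using K qp by (intro sum.cong) fastforce+
      moreover have "(\<Sum>K\<in>snd ` q. ?h K) = (\<Sum>K\<in>snd ` q. \<bar>f (Sup K) - f (Inf K)\<bar>)"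
        using K qp by (intro sum.cong) fastforce+
      ultimately have "(\<Sum>(x,K)\<in>q. \<bar>f (Sup K) - f (Inf K)\<bar>) = (\<Sum>K\<in>snd ` q. \<bar>f (Sup K) - f (Inf K)\<bar>)"
        by simp
      with sm have bad: "(\<Sum>(x,K)\<in>q. \<bar>f (Sup K) - f (Inf K)\<bar>) < e/2" by simp
      \<comment> \<open>Straddle estimate: the tag lies in \<open>K\<close>, so the errors at the
        two endpoints add up to at most \<epsilon> times the length of \<open>K\<close>.\<close>
      have good: "\<bar>measure lborel K * g x - (f (Sup K) - f (Inf K))\<bar> \<le> \<epsilon> * (Sup K - Inf K)"
        if xK: "(x,K) \<in> p - q" for x K
      proof -
        have xN: "x \<notin> N" using xK by (auto simp: q_def)
        obtain u v where uv: "u \<le> v" "K = {u..v}" "x \<in> {u..v}" "{u..v} \<subseteq> {a..b}"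
          using K[of x K] xK by auto
        have "K \<subseteq> ball x (r x)" using fineD[OF fine, of x K] xK xN by (simp add: \<gamma>_def)
        moreover have "u \<in> K" "v \<in> K" using uv by auto
        ultimately have "u \<in> ball x (r x)" "v \<in> ball x (r x)" by blast+
        then have "\<bar>u - x\<bar> < r x" "\<bar>v - x\<bar> < r x" by (auto simp: dist_real_def)
        then have "\<bar>f u - f x - (u - x) * f' x\<bar> \<le> \<epsilon> * \<bar>u - x\<bar>" "\<bar>f v - f x - (v - x) * f' x\<bar> \<le> \<epsilon> * \<bar>v - x\<bar>"
          using r(2)[of x u] r(2)[of x v] uv xN by auto
        moreover have "\<epsilon> * \<bar>u - x\<bar> + \<epsilon> * \<bar>v - x\<bar> = \<epsilon> * (v - u)"
          using uv by (simp add: algebra_simps)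
        moreover have "(v - u) * f' x - (f v - f u) = (f u - f x - (u - x) * f' x) - (f v - f x - (v - x) * f' x)"
          by (simp add: algebra_simps)
        ultimately show ?thesis using uv xN by (simp add: g_def)
      qed
      have ba: "b - a = (\<Sum>(x,K)\<in>p. Sup K - Inf K)" "f b - f a = (\<Sum>(x,K)\<in>p. f(Sup K) - f(Inf K))"
        using additive_tagged_division_1[OF ab p, of "\<lambda>x. x"] additive_tagged_division_1[OF ab p, of f] by auto
      have "\<bar>(\<Sum>(x,K)\<in>p. measure lborel K *\<^sub>R g x) - (f b - f a)\<bar>
          = \<bar>\<Sum>(x,K)\<in>p. measure lborel K * g x - (f (Sup K) - f (Inf K))\<bar>"
        by (simp add: ba(2) sum_subtractf split_def)
      also have "\<dots> \<le> (\<Sum>(x,K)\<in>p. \<bar>measure lborel K * g x - (f (Sup K) - f (Inf K))\<bar>)"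
        unfolding split_def by (rule sum_abs)
      also have "\<dots> = (\<Sum>(x,K)\<in>p-q. \<bar>measure lborel K * g x - (f (Sup K) - f (Inf K))\<bar>)
                  + (\<Sum>(x,K)\<in>q. \<bar>measure lborel K * g x - (f (Sup K) - f (Inf K))\<bar>)"
        by (rule sum.subset_diff[OF qp finp])
      also have "(\<Sum>(x,K)\<in>q. \<bar>measure lborel K * g x - (f (Sup K) - f (Inf K))\<bar>)
                = (\<Sum>(x,K)\<in>q. \<bar>f (Sup K) - f (Inf K)\<bar>)"
        by (intro sum.cong) (auto simp: q_def g_def)
      also have "(\<Sum>(x,K)\<in>p-q. \<bar>measure lborel K * g x - (f (Sup K) - f (Inf K))\<bar>)
              \<le> (\<Sum>(x,K)\<in>p-q. \<epsilon> * (Sup K - Inf K))"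
        using good by (intro sum_mono) auto
      also have "\<dots> \<le> (\<Sum>(x,K)\<in>p. \<epsilon> * (Sup K - Inf K))"
        using finp K \<epsilon> by (intro sum_mono2) (fastforce intro!: mult_nonneg_nonneg)+
      also have "\<dots> = \<epsilon> * (b - a)"
        unfolding ba(1) by (simp add: sum_distrib_left split_def)
      finally show "norm ((\<Sum>(x,K)\<in>p. measure lborel K *\<^sub>R g x) - (f b - f a)) < e"
        using bad \<epsilon>(2) by simp
    qed
  qed
  then show ?thesis
    by (rule has_integral_spike[OF N, rotated]) (auto simp: g_def)
qed

section \<open>Differentiability almost everywhere\<close>

text \<open>The points with arbitrarily small surrounding intervals satisfying \<open>R\<close>, i.e. the set of which
  these intervals form a Vitali covering. Requiring the points to be interior makes it a
  \<open>G\<^sub>\<delta>\<close> set for arbitrary \<open>R\<close>.\<close>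

definition fine_points :: "(real \<Rightarrow> real \<Rightarrow> bool) \<Rightarrow> real set" where
  "fine_points R = {t. \<forall>d>0. \<exists>u v. u < t \<and> t < v \<and> v - u < d \<and> R u v}"

text \<open>It suffices to let the length bound run through \<open>inverse (Suc k)\<close>; each
  \<open>?O k\<close> is a union of open intervals and hence open.\<close>

lemma fine_points_borel: "fine_points R \<in> sets borel"
proof -
  let ?O = "\<lambda>k::nat. \<Union>{{u<..<v} |u v. v - u < inverse (real (Suc k)) \<and> R u v}"
  have "fine_points R = (\<Inter>k. ?O k)"
  proof
    show "fine_points R \<subseteq> (\<Inter>k. ?O k)"
    proof (rule subsetI, rule INT_I)
      fix t k assume "t \<in> fine_points R"
      moreover have "inverse (real (Suc k)) > 0" by simp
      ultimately obtain u v where "u < t" "t < v" "v - u < inverse (real (Suc k))" "R u v"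
        unfolding fine_points_def by blast
      then show "t \<in> ?O k" by (auto intro!: exI[of _ "{u<..<v}"])
    qed
    show "(\<Inter>k. ?O k) \<subseteq> fine_points R"
      unfolding fine_points_def
    proof clarify
      fix t d :: real assume t: "t \<in> (\<Inter>k. ?O k)" and "d > 0"
      then obtain k where k: "inverse (real (Suc k)) < d" using reals_Archimedean by blast
      from t have "t \<in> ?O k" by blast
      then show "\<exists>u v. u < t \<and> t < v \<and> v - u < d \<and> R u v" using k by fastforce
    qed
  qed
  moreover have "?O k \<in> sets borel" for k
    by (rule borel_open) (auto intro!: open_Union)
  ultimately show ?thesis by auto
qed

lemma fine_points_mono: "(\<And>u v. u < v \<Longrightarrow> R u v \<Longrightarrow> R' u v) \<Longrightarrow> fine_points R \<subseteq> fine_points R'"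
  unfolding fine_points_def by (blast intro: less_trans)

text \<open>The Vitali covering theorem yields a countable disjoint family covering \<open>S\<close>
  up to a null set, and finitely many members already carry all but \<open>e\<close> of the measure.
  Disjointness is recorded besides the division property because it also excludes shared
  endpoints.\<close>

lemma Vitali_finite_intervals:
  fixes S U :: "real set"
  assumes S: "S \<in> lmeasurable" and U: "open U" "U \<in> lmeasurable" and SU: "S \<subseteq> U" and e: "e > 0"
    and cov: "S \<subseteq> fine_points R"
  obtains \<D> where "\<D> division_of \<Union>\<D>" "pairwise disjnt \<D>"
    "\<And>K. K \<in> \<D> \<Longrightarrow> \<exists>u v. u < v \<and> K = {u..v} \<and> R u v \<and> K \<subseteq> U"
    "measure lebesgue S - e < measure lebesgue (\<Union>\<D>)"
proof -
  define I where "I = {(u,v). u < v \<and> R u v \<and> {u..v} \<subseteq> U}"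
  \<comment> \<open>The covering theorem speaks of closed balls, so an interval is encoded by its
    midpoint and half its length.\<close>
  define a r where "a = (\<lambda>(u,v). (u+v)/2 :: real)" and "r = (\<lambda>(u,v). (v-u)/2 :: real)"
  have cb: "cball (a i) (r i) = {fst i..snd i}" for i
    by (cases i) (simp add: a_def r_def cball_eq_atLeastAtMost field_simps)
  have ex: "\<exists>i. i \<in> I \<and> t \<in> cball (a i) (r i) \<and> r i < d" if t: "t \<in> S" "0 < d" for t d
  proof -
    obtain \<rho> where \<rho>: "\<rho> > 0" "ball t \<rho> \<subseteq> U" using t SU U(1) open_contains_ball by blast
    have "t \<in> fine_points R" "min d \<rho> > 0" using cov t \<rho>(1) by auto
    then obtain u v where uv: "u < t" "t < v" "v - u < min d \<rho>" "R u v"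
      unfolding fine_points_def by blast
    have "{u..v} \<subseteq> ball t \<rho>" using uv by (auto simp: dist_real_def)
    with \<rho> uv have "(u,v) \<in> I" "t \<in> cball (a (u,v)) (r (u,v))" "r (u,v) < d"
      unfolding cb by (auto simp: I_def r_def)
    then show ?thesis by blast
  qed
  obtain C where C: "countable C" "C \<subseteq> I"
     "pairwise (\<lambda>i j. disjnt (cball (a i) (r i)) (cball (a j) (r j))) C"
     "negligible (S - (\<Union>i \<in> C. cball (a i) (r i)))"
  proof (rule Vitali_covering_theorem_cballs[of I r S a, OF _ ex])
    show "\<And>i. i \<in> I \<Longrightarrow> 0 < r i" by (auto simp: I_def r_def)
  qed
  define \<C> where "\<C> = (\<lambda>i. cball (a i) (r i)) ` C"
  have cC: "countable \<C>" using C(1) by (simp add: \<C>_def)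
  have el: "\<exists>u v. u < v \<and> K = {u..v} \<and> R u v \<and> K \<subseteq> U" if KC: "K \<in> \<C>" for K
  proof -
    obtain i where i: "i \<in> C" "K = {fst i..snd i}" using KC unfolding \<C>_def cb by blast
    then have "i \<in> I" using C(2) by blast
    then show ?thesis using i(2) by (auto simp: I_def)
  qed
  have lm: "K \<in> lmeasurable" if "K \<in> \<C>" for K
    using el[OF that] by auto
  \<comment> \<open>Containment in \<open>U\<close> bounds the measures of all finite subfamilies
    uniformly, as the approximation of the countable union requires.\<close>
  have bd: "measure lebesgue (\<Union>\<D>) \<le> measure lebesgue U" if "\<D> \<subseteq> \<C>" "finite \<D>" for \<D>
  proof (rule measure_mono_fmeasurable)
    show "\<Union>\<D> \<subseteq> U" using that(1) el by blast
    show "\<Union>\<D> \<in> sets lebesgue"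
      using that lm by (intro sets.finite_Union) (blast dest: fmeasurableD)+
  qed (rule U(2))
  obtain \<D> where \<D>: "\<D> \<subseteq> \<C>" "finite \<D>" "measure lebesgue (\<Union>\<C>) - e < measure lebesgue (\<Union>\<D>)"
    using measure_countable_Union_approachable[OF cC e lm bd] by blast
  have mC: "\<Union>\<C> \<in> lmeasurable"
  proof (rule fmeasurableI2[OF U(2)])
    show "\<Union>\<C> \<subseteq> U" using el by blast
    show "\<Union>\<C> \<in> sets lebesgue"
      using lm cC by (intro sets.countable_Union) (blast dest: fmeasurableD)+
  qed
  have neg: "negligible (S - \<Union>\<C>)" using C(4) by (simp add: \<C>_def)
  have "measure lebesgue S \<le> measure lebesgue (\<Union>\<C> \<union> (S - \<Union>\<C>))"
    using fmeasurable.Un[OF mC negligible_imp_measurable[OF neg]] S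
    by (intro measure_mono_fmeasurable) auto
  also have "\<dots> = measure lebesgue (\<Union>\<C>)"
    by (rule measure_negligible_symdiff[OF mC]) (use neg in \<open>auto elim!: negligible_subset\<close>)
  finally have le: "measure lebesgue S \<le> measure lebesgue (\<Union>\<C>)" .
  have disj: "pairwise disjnt \<D>"
  proof (rule pairwiseI)
    fix K K' assume "K \<in> \<D>" "K' \<in> \<D>" "K \<noteq> K'"
    then obtain i j where "i \<in> C" "j \<in> C" "K = cball (a i) (r i)" "K' = cball (a j) (r j)" "i \<noteq> j"
      using \<D>(1) unfolding \<C>_def by blast
    then show "disjnt K K'" using C(3) unfolding pairwise_def by blast
  qed
  have div: "\<D> division_of \<Union>\<D>"
  proof (rule division_ofI)
    fix K assume "K \<in> \<D>"
    moreover from this obtain u v where "u < v" "K = {u..v}" using el[of K] \<D>(1) by blast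
    ultimately show "K \<subseteq> \<Union>\<D>" "K \<noteq> {}" "\<exists>a b. K = cbox a b"
      by auto
  next
    fix K K' assume "K \<in> \<D>" "K' \<in> \<D>" "K \<noteq> K'"
    then have "K \<inter> K' = {}" using disj by (auto simp: pairwise_def disjnt_def)
    then show "interior K \<inter> interior K' = {}" using interior_subset by blast
  qed (use \<D> in auto)
  show thesis
  proof (rule that[OF div disj])
    show "\<exists>u v. u < v \<and> K = {u..v} \<and> R u v \<and> K \<subseteq> U" if "K \<in> \<D>" for K
      using el \<D>(1) that by blast
    show "measure lebesgue S - e < measure lebesgue (\<Union>\<D>)" using \<D>(3) le by linarith
  qed
qed

text \<open>Telescoping. Tags at the left endpoints serve to apply the additivity of increments over
  tagged divisions.\<close>

lemma sum_division_increments: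
  fixes f :: "real \<Rightarrow> real"
  assumes "a \<le> b" "\<D> division_of {a..b}"
  shows "(\<Sum>K\<in>\<D>. f (Sup K) - f (Inf K)) = f b - f a"
proof -
  let ?g = "\<lambda>K::real set. (Inf K, K)"
  have K: "\<exists>u v. u \<le> v \<and> K = {u..v}" if "K \<in> \<D>" for K
    using division_ofD(3,4)[OF assms(2) that] by fastforce
  have "?g ` \<D> tagged_division_of {a..b}"
  proof (rule tagged_division_ofI)
    fix x K assume "(x,K) \<in> ?g ` \<D>"
    then have "K \<in> \<D>" "x = Inf K" by auto
    then show "x \<in> K" "K \<subseteq> {a..b}" "\<exists>a b. K = cbox a b"
      using K[of K] division_ofD(2,4)[OF assms(2), of K] by auto
  next
    fix x K y K' assume "(x,K) \<in> ?g ` \<D>" "(y,K') \<in> ?g ` \<D>" "(x,K) \<noteq> (y,K')"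
    then show "interior K \<inter> interior K' = {}"
      using division_ofD(5)[OF assms(2)] by auto
  next
    have "{K. \<exists>x. (x,K) \<in> ?g ` \<D>} = \<D>" by auto
    then show "\<Union>{K. \<exists>x. (x,K) \<in> ?g ` \<D>} = {a..b}"
      using division_ofD(6)[OF assms(2)] by simp
  qed (use assms(2) in auto)
  from additive_tagged_division_1[OF assms(1) this, of f]
  show ?thesis
    by (subst (asm) sum.reindex) (auto simp: inj_on_def)
qed

text \<open>Negligibility is local, so it suffices to treat the part \<open>W\<close> of
  \<open>E\<close> in a short ball. There, by absolute continuity, disjoint intervals have total
  increment below 1, whereas steep intervals filling more than half of the measure of a
  non-negligible \<open>W\<close> would exceed 1.\<close>

lemma abs_cont_on_infinite_slope_negligible:
  assumes AC: "abs_cont_on {a..b} f" and E: "E \<in> lmeasurable" "E \<subseteq> {a<..<b}"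
    and cov: "\<And>s. E \<subseteq> fine_points (\<lambda>u v. \<bar>f v - f u\<bar> > s * (v - u))"
  shows "negligible E"
  unfolding locally_negligible_alt[of E]
proof
  fix t assume t: "t \<in> E"
  obtain d where d: "d > 0" and small: "\<And>\<D>. \<lbrakk>\<D> division_of \<Union>\<D>; \<Union>\<D> \<subseteq> {a..b}; measure lebesgue (\<Union>\<D>) < d\<rbrakk>
      \<Longrightarrow> (\<Sum>K\<in>\<D>. \<bar>f (Sup K) - f (Inf K)\<bar>) < 1"
    using abs_cont_on_divisionE[OF AC zero_less_one] by blast
  \<comment> \<open>A ball of radius \<open>d/3\<close> has length \<open>2 * d / 3 < d\<close>, so
    every family of disjoint intervals inside \<open>V\<close> is short enough.\<close>
  define V where "V = ball t (d/3) \<inter> {a<..<b}"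
  define W where "W = E \<inter> ball t (d/3)"
  have W: "W \<in> lmeasurable" "W \<subseteq> V" "W \<subseteq> E"
    unfolding W_def V_def using E by (simp_all add: fmeasurable_Int_fmeasurable) auto
  have V: "open V" "V \<in> lmeasurable"
    unfolding V_def by (simp_all add: fmeasurable_Int_fmeasurable open_Int)
  have "negligible W"
  proof (rule ccontr)
    assume "\<not> negligible W"
    then have m: "measure lebesgue W > 0"
      using W(1) by (simp add: negligible_iff_measure zero_less_measure_iff)
    define m where "m = measure lebesgue W"
    have m: "m > 0" using m by (simp add: m_def)
    \<comment> \<open>Slopes above \<open>2/m\<close> on a total length above \<open>m/2\<close>
      give increments summing to more than 1.\<close>
    have "W \<subseteq> fine_points (\<lambda>u v. \<bar>f v - f u\<bar> > 2/m * (v - u))" using cov W(3) by blast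
    from Vitali_finite_intervals[OF W(1) V W(2) half_gt_zero[OF m] this]
    obtain \<D> where \<D>: "\<D> division_of \<Union>\<D>" "pairwise disjnt \<D>"
      "\<And>K. K \<in> \<D> \<Longrightarrow> \<exists>u v. u < v \<and> K = {u..v} \<and> 2/m * (v - u) < \<bar>f v - f u\<bar> \<and> K \<subseteq> V"
      "measure lebesgue W - m/2 < measure lebesgue (\<Union>\<D>)"
      by metis
    have sub: "\<Union>\<D> \<subseteq> V" using \<D>(3) by blast
    have "measure lebesgue (\<Union>\<D>) \<le> measure lebesgue V"
      by (rule measure_mono_fmeasurable[OF sub fmeasurableD[OF lmeasurable_division[OF \<D>(1)]] V(2)])
    also have "\<dots> \<le> measure lebesgue (ball t (d/3))"
      by (rule measure_mono_fmeasurable) (use V in \<open>auto simp: V_def\<close>)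
    also have "\<dots> = 2 * d / 3" using d by (simp add: ball_eq_greaterThanLessThan)
    also have "\<dots> < d" using d by simp
    finally have "(\<Sum>K\<in>\<D>. \<bar>f (Sup K) - f (Inf K)\<bar>) < 1"
      using sub by (intro small[OF \<D>(1)]) (auto simp: V_def)
    moreover have "2/m * measure lebesgue (\<Union>\<D>) \<le> (\<Sum>K\<in>\<D>. \<bar>f (Sup K) - f (Inf K)\<bar>)"
      unfolding content_division[OF \<D>(1), symmetric] sum_distrib_left
    proof (rule sum_mono)
      fix K assume "K \<in> \<D>"
      then obtain u v where "u < v" "K = {u..v}" "\<bar>f v - f u\<bar> > 2/m * (v - u)" using \<D>(3) by blast
      then show "2/m * measure lebesgue K \<le> \<bar>f (Sup K) - f (Inf K)\<bar>" by simp
    qed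
    moreover have "2/m * measure lebesgue (\<Union>\<D>) > 1"
      using \<D>(4) m by (simp add: m_def[symmetric] field_simps)
    ultimately show False by simp
  qed
  then show "\<exists>U. openin (top_of_set E) U \<and> t \<in> U \<and> negligible U"
    using t d by (intro exI[of _ W]) (auto simp: W_def)
qed

text \<open>Cover \<open>E\<close> tightly by intervals of slope below \<open>r\<close>, and inside these by intervals of slope above
  \<open>s\<close>. The part left over between the two coverings has small measure, so by absolute continuity
  \<open>f\<close> varies little there, and comparing increments gives \<open>s |E| \<le> r |E|\<close> up to a small error.\<close>

lemma abs_cont_on_two_slopes_negligible:
  assumes AC: "abs_cont_on {a..b} f" and rs: "r < s"
    and E: "E \<in> lmeasurable" "E \<subseteq> {a<..<b}"
    and lo: "E \<subseteq> fine_points (\<lambda>u v. f v - f u < r * (v - u))"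
    and hi: "E \<subseteq> fine_points (\<lambda>u v. s * (v - u) < f v - f u)"
  shows "negligible E"
proof (rule ccontr)
  let ?\<mu> = "measure lebesgue" and ?\<Delta> = "\<lambda>K. f (Sup K) - f (Inf K)"
  assume "\<not> negligible E"
  define m where "m = ?\<mu> E"
  have m: "m > 0"
    using E(1) \<open>\<not> negligible E\<close> by (simp add: m_def negligible_iff_measure zero_less_measure_iff)
  \<comment> \<open>The argument ends with \<open>(s - r) * m < \<epsilon> * B + e\<close>. This
    choice of \<open>e\<close>, together with \<open>\<epsilon> * B \<le> e\<close>, makes the
    right-hand side at most half of the left-hand side.\<close>
  define e where "e = (s - r) * m / 4"
  have e: "e > 0" using rs m by (simp add: e_def)
  obtain d where d: "d > 0" and small: "\<And>\<D>. \<lbrakk>\<D> division_of \<Union>\<D>; \<Union>\<D> \<subseteq> {a..b}; ?\<mu> (\<Union>\<D>) < d\<rbrakk>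
      \<Longrightarrow> (\<Sum>K\<in>\<D>. \<bar>?\<Delta> K\<bar>) < e"
    using abs_cont_on_divisionE[OF AC e] by blast
  define B where "B = 4 * \<bar>r\<bar> + 3 * (s - r)"
  have B: "B > 0" using rs by (simp add: B_def add_nonneg_pos)
  \<comment> \<open>The measure left over between the two coverings will be below
    \<open>4 * \<epsilon>\<close>, which must not exceed \<open>d\<close>.\<close>
  define \<epsilon> where "\<epsilon> = min (d/4) (e / B)"
  have \<epsilon>: "\<epsilon> > 0" "4 * \<epsilon> \<le> d" "\<epsilon> * B \<le> e"
    using d e B by (auto simp: \<epsilon>_def min_def field_simps)
  obtain T where T: "open T" "E \<subseteq> T" "T - E \<in> lmeasurable" "emeasure lebesgue (T - E) < ennreal \<epsilon>"
    using sets_lebesgue_outer_open[OF fmeasurableD[OF E(1)] \<epsilon>(1)] by blast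
  define U where "U = T \<inter> {a<..<b}"
  have "bounded U" by (rule bounded_subset[of "{a<..<b}"]) (auto simp: U_def)
  then have U: "open U" "U \<in> lmeasurable" "E \<subseteq> U"
    using T E by (auto simp: U_def intro!: lmeasurable_open)
  have "?\<mu> (T - E) < \<epsilon>"
    using T(3,4) \<epsilon>(1) by (simp add: emeasure_eq_measure2 ennreal_less_iff)
  moreover have "?\<mu> U \<le> ?\<mu> (E \<union> (T - E))"
    using U fmeasurable.Un[OF E(1) T(3)] by (intro measure_mono_fmeasurable) (auto simp: U_def)
  moreover have "?\<mu> (E \<union> (T - E)) \<le> ?\<mu> E + ?\<mu> (T - E)"
    using E(1) T(3) by (intro measure_Un_le) auto
  ultimately have \<mu>U: "?\<mu> U < m + \<epsilon>" by (simp add: m_def)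

  from Vitali_finite_intervals[OF E(1) U \<epsilon>(1) lo]
  obtain P where P: "P division_of \<Union>P" "pairwise disjnt P"
    "\<And>K. K \<in> P \<Longrightarrow> \<exists>u v. u < v \<and> K = {u..v} \<and> f v - f u < r * (v - u) \<and> K \<subseteq> U"
    "?\<mu> E - \<epsilon> < ?\<mu> (\<Union>P)"
    by metis
  have finP: "finite P" using P(1) by blast
  have PU: "\<Union>P \<subseteq> U" using P(3) by blast
  have lmP: "\<Union>P \<in> lmeasurable" by (rule lmeasurable_division[OF P(1)])
  have \<mu>P: "?\<mu> (\<Union>P) \<le> ?\<mu> U"
    by (rule measure_mono_fmeasurable[OF PU fmeasurableD[OF lmP] U(2)])

  \<comment> \<open>Around a point of an interior, all sufficiently short intervals lie inside one
    interval of \<open>P\<close>; only finitely many endpoints are given up.\<close>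
  define V where "V = (\<Union>K\<in>P. interior K)"
  define E' where "E' = E \<inter> V"
  have V: "open V" "V \<in> lmeasurable"
  proof -
    show "open V" by (auto simp: V_def)
    moreover have "V \<subseteq> U" using PU interior_subset by (fastforce simp: V_def)
    ultimately show "V \<in> lmeasurable"
      using \<open>bounded U\<close> bounded_subset by (blast intro: lmeasurable_open)
  qed
  have E': "E' \<in> lmeasurable" "E' \<subseteq> V"
    using fmeasurable_Int_fmeasurable[OF E(1) fmeasurableD[OF V(2)]] by (auto simp: E'_def)
  have negV: "negligible (\<Union>P - V)"
  proof (rule negligible_subset)
    show "negligible (\<Union>K\<in>P. K - interior K)"
    proof (rule negligible_Union; clarsimp simp: finP)
      fix K assume "K \<in> P"
      then obtain u v where "K = {u..v}" using P(3) by blast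
      then have "K - interior K \<subseteq> {u,v}" by auto
      then show "negligible (K - interior K)" using negligible_finite[of "{u,v}"] negligible_subset by blast
    qed
  qed (auto simp: V_def)
  \<comment> \<open>Up to a null set, \<open>E\<close> loses only a part of
    \<open>U - \<Union>P\<close>. Its measure is below \<open>2 * \<epsilon>\<close>, since
    \<open>U\<close> has measure below \<open>m + \<epsilon>\<close> and \<open>\<Union>P\<close>
    above \<open>m - \<epsilon>\<close>.\<close>
  have "?\<mu> E \<le> ?\<mu> (E' \<union> (U - \<Union>P) \<union> (\<Union>P - V))"
  proof (rule measure_mono_fmeasurable)
    show "E' \<union> (U - \<Union>P) \<union> (\<Union>P - V) \<in> lmeasurable"
      by (rule fmeasurable.Un[OF fmeasurable.Un[OF E'(1) fmeasurable.Diff[OF U(2) lmP]]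
            negligible_imp_measurable[OF negV]])
    show "E \<subseteq> E' \<union> (U - \<Union>P) \<union> (\<Union>P - V)" using U(3) unfolding E'_def by blast
    show "E \<in> sets lebesgue" by (rule fmeasurableD[OF E(1)])
  qed
  also have "\<dots> \<le> ?\<mu> E' + ?\<mu> (U - \<Union>P) + ?\<mu> (\<Union>P - V)"
  proof (rule order_trans[OF measure_Un_le add_right_mono[OF measure_Un_le]])
    show "\<Union>P - V \<in> sets lebesgue" by (rule negligible_imp_sets[OF negV])
    show "U - \<Union>P \<in> sets lebesgue" by (rule fmeasurableD[OF fmeasurable.Diff[OF U(2) lmP]])
    then show "E' \<union> (U - \<Union>P) \<in> sets lebesgue" "E' \<in> sets lebesgue" using E'(1) by auto
  qed
  also have "?\<mu> (\<Union>P - V) = 0" using negV by (rule negligible_imp_measure0)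
  also have "?\<mu> (U - \<Union>P) = ?\<mu> U - ?\<mu> (\<Union>P)"
    using U lmP PU by (intro measurable_measure_Diff) auto
  finally have \<mu>E': "?\<mu> E' > m - 2 * \<epsilon>"
    using \<mu>U P(4) by (simp add: m_def)

  have "E' \<subseteq> fine_points (\<lambda>u v. s * (v - u) < f v - f u \<and> (\<exists>K\<in>P. {u..v} \<subseteq> K))"
    unfolding fine_points_def
  proof clarify
    fix t d :: real assume t: "t \<in> E'" and "d > 0"
    then obtain K where K: "K \<in> P" "t \<in> interior K" by (auto simp: E'_def V_def)
    then obtain \<rho> where \<rho>: "\<rho> > 0" "ball t \<rho> \<subseteq> K"
      by (meson mem_interior)
    have "t \<in> fine_points (\<lambda>u v. s * (v - u) < f v - f u)" "min d \<rho> > 0"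
      using t hi \<rho> \<open>d > 0\<close> by (auto simp: E'_def)
    then obtain u v where uv: "u < t" "t < v" "v - u < min d \<rho>" "s * (v - u) < f v - f u"
      unfolding fine_points_def by blast
    have "{u..v} \<subseteq> ball t \<rho>" using uv by (auto simp: dist_real_def)
    then show "\<exists>u v. u < t \<and> t < v \<and> v - u < d \<and> s * (v - u) < f v - f u \<and> (\<exists>K\<in>P. {u..v} \<subseteq> K)"
      using uv \<rho> K by (intro exI[of _ u] exI[of _ v]) auto
  qed
  from Vitali_finite_intervals[OF E'(1) V E'(2) \<epsilon>(1) this]
  obtain Q where Q: "Q division_of \<Union>Q" "pairwise disjnt Q"
    "\<And>K. K \<in> Q \<Longrightarrow> \<exists>u v. u < v \<and> K = {u..v} \<and> (s * (v - u) < f v - f u \<and> (\<exists>K\<in>P. {u..v} \<subseteq> K)) \<and> K \<subseteq> V"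
    "?\<mu> E' - \<epsilon> < ?\<mu> (\<Union>Q)"
    by metis
  have finQ: "finite Q" using Q(1) by blast

  \<comment> \<open>Inside each \<open>K\<close> of \<open>P\<close> the intervals of
    \<open>Q\<close> are completed to a division \<open>D K\<close>; the added intervals
    \<open>RK K\<close> form the leftover part.\<close>
  define QK where "QK K = {q\<in>Q. q \<subseteq> K}" for K
  have QK: "QK K \<subseteq> Q" for K by (auto simp: QK_def)
  have "\<exists>D. QK K \<subseteq> D \<and> D division_of K" if K: "K \<in> P" for K
  proof -
    obtain u v where uv: "K = cbox u v" using P(3)[OF K] by auto
    have 1: "QK K division_of \<Union>(QK K)" by (rule division_of_subset[OF Q(1) QK])
    have 2: "\<Union>(QK K) \<subseteq> cbox u v" by (auto simp: QK_def uv)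
    obtain D where "QK K \<subseteq> D" "D division_of cbox u v"
      by (rule partial_division_extend_interval[OF 1 2])
    then show ?thesis unfolding uv by blast
  qed
  then obtain D where D: "\<And>K. K \<in> P \<Longrightarrow> QK K \<subseteq> D K" "\<And>K. K \<in> P \<Longrightarrow> D K division_of K"
    by metis
  define RK where "RK K = D K - QK K" for K
  define R where "R = (\<Union>K\<in>P. RK K)"
  have Kdisj: "K \<inter> K' = {}" if "K \<in> P" "K' \<in> P" "K \<noteq> K'" for K K'
    using P(2) that by (auto simp: pairwise_def disjnt_def)
  have DK: "k \<noteq> {}" "k \<subseteq> K" "\<exists>u v. k = cbox u v" if "K \<in> P" "k \<in> D K" for K k
    using division_ofD(2,3,4)[OF D(2)[OF that(1)] that(2)] by blast+
  have finD: "finite (D K)" if "K \<in> P" for K using D(2)[OF that] by blast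
  have Ddisj: "D K \<inter> D K' = {}" if "K \<in> P" "K' \<in> P" "K \<noteq> K'" for K K'
  proof (rule ccontr)
    assume "D K \<inter> D K' \<noteq> {}"
    then obtain k where k: "k \<in> D K" "k \<in> D K'" by blast
    have "k \<noteq> {}" "k \<subseteq> K" "k \<subseteq> K'" using DK(1,2)[OF that(1) k(1)] DK(2)[OF that(2) k(2)] .
    then show False using Kdisj[OF that] by blast
  qed
  have QQ: "Q = (\<Union>K\<in>P. QK K)" 
  proof
    show "Q \<subseteq> (\<Union>K\<in>P. QK K)"
    proof
      fix q assume q: "q \<in> Q"
      from Q(3)[OF q] obtain K where "K \<in> P" "q \<subseteq> K" by blast
      with q show "q \<in> (\<Union>K\<in>P. QK K)" by (auto simp: QK_def)
    qed
  qed (use QK in blast)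
  have sumQ: "sum g Q = (\<Sum>K\<in>P. sum g (QK K))" for g :: "real set \<Rightarrow> real"
  proof -
    have "sum g (\<Union>K\<in>P. QK K) = (\<Sum>K\<in>P. sum g (QK K))"
    proof (rule sum.UNION_disjoint[OF finP]; intro ballI impI)
      fix K show "finite (QK K)" using QK finQ finite_subset by blast
      fix K' assume "K \<in> P" "K' \<in> P" "K \<noteq> K'"
      then show "QK K \<inter> QK K' = {}" using Ddisj[of K K'] D(1)[of K] D(1)[of K'] by blast
    qed
    then show ?thesis using QQ by simp
  qed
  have sumR: "sum g R = (\<Sum>K\<in>P. sum g (RK K))" for g :: "real set \<Rightarrow> real"
    unfolding R_def using finP finD Ddisj
    by (intro sum.UNION_disjoint) (auto simp: RK_def)
  have sumD: "sum g (D K) = sum g (RK K) + sum g (QK K)" if "K \<in> P" for g :: "real set \<Rightarrow> real" and K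
    unfolding RK_def using sum.subset_diff[OF D(1)[OF that] finD[OF that]] .
  have divR: "R division_of \<Union>R"
  proof (rule division_ofI)
    show "finite R" unfolding R_def RK_def using finP finD by blast
    fix k assume k: "k \<in> R"
    then obtain K where K: "K \<in> P" "k \<in> D K" by (auto simp: R_def RK_def)
    show "k \<subseteq> \<Union>R" "k \<noteq> {}" "\<exists>a b. k = cbox a b" using k DK[OF K] by auto
    fix k' assume k': "k' \<in> R" "k \<noteq> k'"
    then obtain K' where K': "K' \<in> P" "k' \<in> D K'" by (auto simp: R_def RK_def)
    show "interior k \<inter> interior k' = {}"
    proof (cases "K = K'")
      case True
      then show ?thesis using division_ofD(5)[OF D(2)[OF K(1)]] K K' k' by blast
    next
      case False
      then have "k \<inter> k' = {}" using Kdisj[of K K'] DK(2)[OF K] DK(2)[OF K'] K K' by blast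
      then show ?thesis using interior_subset by blast
    qed
  qed simp
  define l where "l = ?\<mu> (\<Union>P)"
  define l' where "l' = ?\<mu> (\<Union>Q)"
  have "l = (\<Sum>K\<in>P. sum ?\<mu> (D K))"
    unfolding l_def content_division[OF P(1), symmetric]
    by (intro sum.cong refl content_division[OF D(2), symmetric])
  also have "\<dots> = sum ?\<mu> R + sum ?\<mu> Q"
    unfolding sumR sumQ sum.distrib[symmetric] by (intro sum.cong refl sumD)
  finally have ll': "?\<mu> (\<Union>R) = l - l'"
    by (simp add: content_division[OF divR] content_division[OF Q(1)] l'_def)
  \<comment> \<open>Here \<open>l < m + \<epsilon>\<close> and
    \<open>l' > m - 3 * \<epsilon>\<close>.\<close>
  have "l - l' < 4 * \<epsilon>"
    using \<mu>P \<mu>U \<mu>E' Q(4) by (simp add: l_def l'_def)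
  moreover have "\<Union>R \<subseteq> {a..b}"
  proof
    fix t assume "t \<in> \<Union>R"
    then obtain K k where "K \<in> P" "k \<in> D K" "t \<in> k" by (auto simp: R_def RK_def)
    then have "t \<in> U" using DK(2) PU by blast
    then show "t \<in> {a..b}" by (auto simp: U_def)
  qed
  ultimately have smR: "(\<Sum>K\<in>R. \<bar>?\<Delta> K\<bar>) < e"
    using \<epsilon>(2) ll' by (intro small[OF divR]) auto
  have "s * l' \<le> sum ?\<Delta> Q"
    unfolding l'_def content_division[OF Q(1), symmetric] sum_distrib_left
  proof (rule sum_mono)
    fix q assume "q \<in> Q"
    then obtain u v where "u < v" "q = {u..v}" "s * (v - u) < f v - f u" using Q(3) by blast
    then show "s * ?\<mu> q \<le> ?\<Delta> q" by simp
  qed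
  moreover have "sum ?\<Delta> R \<ge> - (\<Sum>K\<in>R. \<bar>?\<Delta> K\<bar>)"
    unfolding sum_negf[symmetric] by (intro sum_mono) auto
  moreover have "sum ?\<Delta> R + sum ?\<Delta> Q = sum ?\<Delta> P"
  proof -
    have "sum ?\<Delta> R + sum ?\<Delta> Q = (\<Sum>K\<in>P. sum ?\<Delta> (D K))"
      unfolding sumR sumQ sum.distrib[symmetric] by (intro sum.cong refl sumD[symmetric])
    also have "\<dots> = sum ?\<Delta> P"
    proof (rule sum.cong[OF refl])
      fix K assume K: "K \<in> P"
      then obtain u v where uv: "u < v" "K = {u..v}" using P(3) by blast
      then show "sum ?\<Delta> (D K) = ?\<Delta> K"
        using sum_division_increments[of u v "D K" f] D(2)[OF K] by simp
    qed
    finally show ?thesis .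
  qed
  moreover have "sum ?\<Delta> P \<le> r * l"
    unfolding l_def content_division[OF P(1), symmetric] sum_distrib_left
  proof (rule sum_mono)
    fix q assume "q \<in> P"
    then obtain u v where "u < v" "q = {u..v}" "f v - f u < r * (v - u)" using P(3) by blast
    then show "?\<Delta> q \<le> r * ?\<mu> q" by simp
  qed
  \<comment> \<open>The steep intervals contribute at least \<open>s * l'\<close> and the leftover
    more than \<open>- e\<close>, while the total increment over \<open>P\<close> is at most
    \<open>r * l\<close>.\<close>
  ultimately have "s * l' - e \<le> r * l" using smR by linarith
  moreover have "r * (l - l') \<le> \<bar>r\<bar> * (4 * \<epsilon>)"
  proof -
    have "r * (l - l') \<le> \<bar>r\<bar> * (l - l')"
      using ll' measure_nonneg[of lebesgue "\<Union>R"] by (intro mult_right_mono) auto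
    also have "\<dots> \<le> \<bar>r\<bar> * (4 * \<epsilon>)" using \<open>l - l' < 4 * \<epsilon>\<close> by (intro mult_left_mono) auto
    finally show ?thesis .
  qed
  moreover have "(s - r) * (m - 3 * \<epsilon>) < (s - r) * l'"
    using rs \<mu>E' Q(4) by (intro mult_strict_left_mono) (auto simp: l'_def)
  ultimately have "(s - r) * m < \<epsilon> * B + e"
    by (simp add: B_def algebra_simps)
  also have "\<dots> \<le> 2 * e" using \<epsilon>(3) by simp
  also have "\<dots> = (s - r) * m / 2" by (simp add: e_def)
  finally show False using rs m by simp
qed

text \<open>Outside \<open>N1\<close> and \<open>N2\<close>, the slopes over intervals around the
  point are eventually bounded and cannot keep crossing two rational thresholds, so they converge as
  the intervals shrink. Continuity then admits the point itself as an endpoint, which gives the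
  derivative.\<close>

lemma abs_cont_on_differentiable_AE:
  assumes AC: "abs_cont_on {a..b} f"
  obtains N where "negligible N" "\<And>t. t \<in> {a<..<b} - N \<Longrightarrow> f differentiable (at t)"
proof -
  define hi where "hi s = fine_points (\<lambda>u v. s * (v - u) < f v - f u)" for s
  define lo where "lo s = fine_points (\<lambda>u v. f v - f u < s * (v - u))" for s
  define steep where "steep s = fine_points (\<lambda>u v. \<bar>f v - f u\<bar> > s * (v - u))" for s
  \<comment> \<open>Rational thresholds keep the union countable.\<close>
  define N1 where "N1 = (\<Union>(p,q)\<in>{(p,q). p \<in> \<rat> \<and> q \<in> \<rat> \<and> p < q}. {a<..<b} \<inter> (lo p \<inter> hi q))"
  define N2 where "N2 = {a<..<b} \<inter> (\<Inter>k::nat. steep (real k))"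
  have borel: "hi s \<in> sets borel" "lo s \<in> sets borel" "steep s \<in> sets borel" for s
    by (simp_all add: hi_def lo_def steep_def fine_points_borel)
  have lm: "{a<..<b} \<inter> S \<in> lmeasurable" if "S \<in> sets borel" for S
    using that by (intro fmeasurable_Int_fmeasurable) auto
  have hi_anti: "hi s' \<subseteq> hi s" if "s \<le> s'" for s s'
    unfolding hi_def
  proof (rule fine_points_mono)
    fix u v :: real assume "u < v" "s' * (v - u) < f v - f u"
    moreover from this that have "s * (v - u) \<le> s' * (v - u)" by (intro mult_right_mono) auto
    ultimately show "s * (v - u) < f v - f u" by linarith
  qed
  have lo_mono: "lo s \<subseteq> lo s'" if "s \<le> s'" for s s'
    unfolding lo_def
  proof (rule fine_points_mono)
    fix u v :: real assume "u < v" "f v - f u < s * (v - u)"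
    moreover from this that have "s * (v - u) \<le> s' * (v - u)" by (intro mult_right_mono) auto
    ultimately show "f v - f u < s' * (v - u)" by linarith
  qed
  have "negligible N1"
    unfolding N1_def
  proof (rule negligible_countable_Union)
    have "{(p,q). p \<in> \<rat> \<and> q \<in> \<rat> \<and> p < q} \<subseteq> (\<rat> \<times> \<rat> :: (real \<times> real) set)" by auto
    then have "countable {(p::real,q::real). p \<in> \<rat> \<and> q \<in> \<rat> \<and> p < q}"
      by (rule countable_subset) (intro countable_SIGMA countable_rat)
    then show "countable ((\<lambda>(p,q). {a<..<b} \<inter> (lo p \<inter> hi q)) ` {(p,q). p \<in> \<rat> \<and> q \<in> \<rat> \<and> p < q})"
      by (rule countable_image)
    fix S assume "S \<in> (\<lambda>(p,q). {a<..<b} \<inter> (lo p \<inter> hi q)) ` {(p,q). p \<in> \<rat> \<and> q \<in> \<rat> \<and> p < q}"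
    then obtain p q where pq: "p < q" "S = {a<..<b} \<inter> (lo p \<inter> hi q)" by auto
    show "negligible S"
    proof (rule abs_cont_on_two_slopes_negligible[OF AC pq(1)])
      show "S \<in> lmeasurable" unfolding pq(2) using borel by (intro lm) auto
    qed (auto simp: pq(2) lo_def hi_def)
  qed
  moreover have "negligible N2"
  proof (rule abs_cont_on_infinite_slope_negligible[OF AC])
    show "N2 \<in> lmeasurable" unfolding N2_def using borel by (intro lm) auto
    fix s :: real
    obtain k :: nat where k: "s \<le> real k" using real_arch_simple by blast
    have "steep (real k) \<subseteq> steep s"
      unfolding steep_def
    proof (rule fine_points_mono)
      fix u v :: real assume "u < v" "real k * (v - u) < \<bar>f v - f u\<bar>"
      moreover from this k have "s * (v - u) \<le> real k * (v - u)" by (intro mult_right_mono) auto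
      ultimately show "s * (v - u) < \<bar>f v - f u\<bar>" by linarith
    qed
    then show "N2 \<subseteq> fine_points (\<lambda>u v. s * (v - u) < \<bar>f v - f u\<bar>)"
      unfolding steep_def[of s, symmetric] by (auto simp: N2_def)
  qed (auto simp: N2_def)
  ultimately have neg: "negligible (N1 \<union> N2)" by simp
  have "f differentiable (at t)" if t: "t \<in> {a<..<b}" "t \<notin> N1 \<union> N2" for t
  proof -
    have not_fine: "\<exists>d>0. \<forall>u v. u < t \<longrightarrow> t < v \<longrightarrow> v - u < d \<longrightarrow> \<not> R u v" if "t \<notin> fine_points R" for R
      using that unfolding fine_points_def by blast
    obtain k :: nat where "t \<notin> steep (real k)" using t by (auto simp: N2_def)
    from not_fine[OF this[unfolded steep_def]]
    obtain d0 where d0: "d0 > 0" "\<And>u v. u < t \<Longrightarrow> t < v \<Longrightarrow> v - u < d0 \<Longrightarrow> \<bar>f v - f u\<bar> \<le> real k * (v - u)"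
      unfolding not_less by blast
    \<comment> \<open>\<open>Z\<close> consists of the eventual upper bounds for slopes over
      intervals around \<open>t\<close>, so its infimum \<open>L\<close> is their upper limit and
      the candidate derivative.\<close>
    define Z where "Z = {s. t \<notin> hi s}"
    define L where "L = Inf Z"
    have kZ: "real k \<in> Z"
    proof -
      have False if "t \<in> hi (real k)"
      proof -
        from that d0(1) obtain u v where uv: "u < t" "t < v" "v - u < d0" "real k * (v - u) < f v - f u"
          unfolding hi_def fine_points_def by blast
        then show False using d0(2)[OF uv(1-3)] by linarith
      qed
      then show ?thesis by (auto simp: Z_def)
    qed
    \<comment> \<open>Otherwise a symmetric interval short enough for both bounds would have slope
      below \<open>- real k\<close>.\<close>
    have bZ: "- real k \<le> z" if "z \<in> Z" for z
    proof (rule ccontr)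
      assume *: "\<not> - real k \<le> z"
      have "t \<notin> fine_points (\<lambda>u v. z * (v - u) < f v - f u)" using that by (simp add: Z_def hi_def)
      from not_fine[OF this]
      obtain d1 where d1: "d1 > 0" "\<And>u v. u < t \<Longrightarrow> t < v \<Longrightarrow> v - u < d1 \<Longrightarrow> f v - f u \<le> z * (v - u)"
        unfolding not_less by blast
      define h where "h = min d0 d1 / 3"
      have h: "h > 0" "2 * h < d0" "2 * h < d1" using d0(1) d1(1) by (auto simp: h_def min_def)
      have "f (t+h) - f (t-h) \<le> z * (2 * h)" "\<bar>f (t+h) - f (t-h)\<bar> \<le> real k * (2 * h)"
        using d0(2)[of "t-h" "t+h"] d1(2)[of "t-h" "t+h"] h by auto
      then have "0 \<le> (z + real k) * (2 * h)" by (simp add: algebra_simps)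
      moreover have "(z + real k) * (2 * h) < 0" using * h by (intro mult_neg_pos) auto
      ultimately show False by simp
    qed
    then have bdd: "bdd_below Z" by (auto simp: bdd_below_def)
    have upper: "t \<notin> hi (L + \<epsilon>)" if \<epsilon>: "\<epsilon> > 0" for \<epsilon>
    proof -
      obtain z where "z \<in> Z" "z < L + \<epsilon>"
        using cInf_lessD[of Z "L + \<epsilon>"] kZ \<epsilon> by (auto simp: L_def)
      then show ?thesis using hi_anti[of z "L + \<epsilon>"] by (auto simp: Z_def)
    qed
    \<comment> \<open>Choose rationals \<open>p < q\<close> between \<open>L - \<epsilon>\<close>
      and \<open>L\<close>. Slopes above \<open>q\<close> occur on arbitrarily short intervals
      around \<open>t\<close>, so avoiding \<open>N1\<close> forbids slopes below \<open>p\<close>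
      on short intervals.\<close>
    have lower: "t \<notin> lo (L - \<epsilon>)" if \<epsilon>: "\<epsilon> > 0" for \<epsilon>
    proof -
      obtain q where q: "q \<in> \<rat>" "L - \<epsilon> < q" "q < L"
        using Rats_dense_in_real[of "L - \<epsilon>" L] \<epsilon> by auto
      obtain p where p: "p \<in> \<rat>" "L - \<epsilon> < p" "p < q"
        using Rats_dense_in_real[of "L - \<epsilon>" q] q by auto
      have "q \<notin> Z" using q(3) bdd cInf_lower[of q Z] by (auto simp: L_def)
      then have "t \<in> hi q" by (simp add: Z_def)
      moreover have "t \<notin> lo p \<inter> hi q" using t p q by (auto simp: N1_def)
      ultimately show ?thesis using lo_mono[of "L - \<epsilon>" p] p by auto
    qed
    have cont: "isCont f t"
      using abs_cont_on_imp_continuous_on[OF AC] t(1) by (auto intro!: continuous_on_interior)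
    have "(f has_real_derivative L) (at t)"
      unfolding has_field_derivative_def has_derivative_within_alt
    proof (intro conjI allI impI)
      show "bounded_linear ((*) L)" by (rule bounded_linear_mult_right)
      fix \<epsilon> :: real assume \<epsilon>: "\<epsilon> > 0"
      from not_fine[OF upper[OF \<epsilon>, unfolded hi_def]]
      obtain d1 where d1: "d1 > 0" "\<And>u v. u < t \<Longrightarrow> t < v \<Longrightarrow> v - u < d1 \<Longrightarrow> f v - f u \<le> (L + \<epsilon>) * (v - u)"
        unfolding not_less by blast
      from not_fine[OF lower[OF \<epsilon>, unfolded lo_def]]
      obtain d2 where d2: "d2 > 0" "\<And>u v. u < t \<Longrightarrow> t < v \<Longrightarrow> v - u < d2 \<Longrightarrow> f v - f u \<ge> (L - \<epsilon>) * (v - u)"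
        unfolding not_less by blast
      define d where "d = min d1 d2"
      have d: "d > 0" using d1 d2 by (simp add: d_def)
      have est: "\<bar>f v - f u - L * (v - u)\<bar> \<le> \<epsilon> * (v - u)" if "u < t" "t < v" "v - u < d" for u v
        using d1(2)[of u v] d2(2)[of u v] that by (simp add: d_def abs_le_iff algebra_simps)
      \<comment> \<open>The estimate \<open>est\<close> needs \<open>t\<close> strictly inside the
        interval; by continuity the left endpoint can be moved to \<open>t\<close>.\<close>
      have right: "\<bar>f y - f t - L * (y - t)\<bar> \<le> \<epsilon> * (y - t)" if y: "t < y" "y - t < d" for y
      proof (rule tendsto_le[OF trivial_limit_at_left_real[of t]])
        show "((\<lambda>u. \<epsilon> * (y - u)) \<longlongrightarrow> \<epsilon> * (y - t)) (at_left t)" by (intro tendsto_intros)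
        show "((\<lambda>u. \<bar>f y - f u - L * (y - u)\<bar>) \<longlongrightarrow> \<bar>f y - f t - L * (y - t)\<bar>) (at_left t)"
          using cont by (intro tendsto_intros) (auto simp: isCont_def filterlim_at_split)
        show "\<forall>\<^sub>F u in at_left t. \<bar>f y - f u - L * (y - u)\<bar> \<le> \<epsilon> * (y - u)"
          unfolding eventually_at_left_field using y
          by (intro exI[of _ "y - d"]) (auto intro!: est)
      qed
      have left: "\<bar>f t - f y - L * (t - y)\<bar> \<le> \<epsilon> * (t - y)" if y: "y < t" "t - y < d" for y
      proof (rule tendsto_le[OF trivial_limit_at_right_real[of t]])
        show "((\<lambda>v. \<epsilon> * (v - y)) \<longlongrightarrow> \<epsilon> * (t - y)) (at_right t)" by (intro tendsto_intros)
        show "((\<lambda>v. \<bar>f v - f y - L * (v - y)\<bar>) \<longlongrightarrow> \<bar>f t - f y - L * (t - y)\<bar>) (at_right t)"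
          using cont by (intro tendsto_intros) (auto simp: isCont_def filterlim_at_split)
        show "\<forall>\<^sub>F v in at_right t. \<bar>f v - f y - L * (v - y)\<bar> \<le> \<epsilon> * (v - y)"
          unfolding eventually_at_right_field using y
          by (intro exI[of _ "y + d"]) (auto intro!: est)
      qed
      show "\<exists>d>0. \<forall>y\<in>UNIV. norm (y - t) < d \<longrightarrow> norm (f y - f t - L * (y - t)) \<le> \<epsilon> * norm (y - t)"
      proof (intro exI[of _ d] conjI ballI impI d)
        fix y :: real assume y: "norm (y - t) < d"
        consider "y < t" | "y = t" | "t < y" by linarith
        then show "norm (f y - f t - L * (y - t)) \<le> \<epsilon> * norm (y - t)"
        proof cases
          case 1
          have "f y - f t - L * (y - t) = - (f t - f y - L * (t - y))" by (simp add: algebra_simps)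
          then have "norm (f y - f t - L * (y - t)) = \<bar>f t - f y - L * (t - y)\<bar>"
            by (metis abs_minus_cancel real_norm_def)
          moreover have "norm (y - t) = t - y" using 1 by simp
          ultimately show ?thesis using left[of y] y 1 by metis
        next
          case 3
          then show ?thesis using right[of y] y by simp
        qed simp
      qed
    qed
    then show ?thesis using real_differentiable_def by blast
  qed
  then show thesis using that[OF neg] by blast
qed

section \<open>Integrating differential inequalities\<close>

text \<open>Integrate \<open>p \<le> q + G'\<close> over \<open>{0..T}\<close>, bound the increment
  of \<open>G\<close> by \<open>C\<close>, and let \<open>T\<close> grow. Nonnegative integrals over
  \<open>lborel\<close> and over its completion agree, so measurability in the completed sense
  suffices.\<close>

lemma nn_integral_le_potential:
  fixes p q G G' :: "real \<Rightarrow> real"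
  assumes p: "p \<in> borel_measurable (lebesgue_on {0..})" and q: "q \<in> borel_measurable (lebesgue_on {0..})"
    and nonneg: "\<And>t. 0 \<le> t \<Longrightarrow> 0 \<le> p t" "\<And>t. 0 \<le> t \<Longrightarrow> 0 \<le> q t"
    and AC: "\<And>T. abs_cont_on {0..T} G" and N: "negligible N"
    and der: "\<And>t. t \<in> {0..} - N \<Longrightarrow> (G has_real_derivative G' t) (at t)"
    and le: "\<And>t. t \<in> {0..} - N \<Longrightarrow> p t \<le> q t + G' t"
    and C: "\<And>T. 0 \<le> T \<Longrightarrow> G T - G 0 \<le> C"
  shows "(\<integral>\<^sup>+t. ennreal (p t) * indicator {0..} t \<partial>lborel)
    \<le> (\<integral>\<^sup>+t. ennreal (q t) * indicator {0..} t \<partial>lborel) + ennreal C"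
proof (cases "(\<integral>\<^sup>+t. ennreal (q t) * indicator {0..} t \<partial>lborel) = \<infinity>")
  case True
  then show ?thesis by simp
next
  case False
  \<comment> \<open>Hence \<open>ennreal C\<close> does not truncate.\<close>
  have C0: "C \<ge> 0" using C[of 0] by simp
  have meas: "(\<lambda>t. indicator {0..} t *\<^sub>R f t) \<in> borel_measurable lebesgue"
    if "f \<in> borel_measurable (lebesgue_on {0..})" for f :: "real \<Rightarrow> real"
  proof -
    have "(\<lambda>t. if t \<in> {0..} then f t else 0) \<in> borel_measurable lebesgue"
      using that by (subst borel_measurable_if) auto
    moreover have "(\<lambda>t. if t \<in> {0..} then f t else 0) = (\<lambda>t. indicator {0..} t *\<^sub>R f t)"
      by (auto simp: fun_eq_iff)
    ultimately show ?thesis by (simp only:)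
  qed
  \<comment> \<open>A finite integral makes \<open>q\<close> integrable, so the integral of
    \<open>q + G'\<close> can be split.\<close>
  have q_int: "q absolutely_integrable_on {0..}"
    unfolding set_integrable_def
  proof (rule integrableI_nonneg[OF meas[OF q]])
    show "AE t in lebesgue. 0 \<le> indicator {0..} t *\<^sub>R q t" using nonneg by (auto simp: indicator_def)
    have "(\<integral>\<^sup>+t. ennreal (indicator {0..} t *\<^sub>R q t) \<partial>lebesgue) = (\<integral>\<^sup>+t. ennreal (q t) * indicator {0..} t \<partial>lborel)"
      unfolding nn_integral_completion by (intro nn_integral_cong) (auto simp: indicator_def)
    then show "(\<integral>\<^sup>+t. ennreal (indicator {0..} t *\<^sub>R q t) \<partial>lebesgue) < \<infinity>"
      using False by (simp add: less_top)
  qed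
  have bound: "(\<integral>\<^sup>+t. ennreal (p t) * indicator {0..T} t \<partial>lebesgue)
      \<le> (\<integral>\<^sup>+t. ennreal (q t) * indicator {0..} t \<partial>lborel) + ennreal C" if T: "0 \<le> T" for T
  proof -
    \<comment> \<open>The value 0 on \<open>N\<close> makes \<open>h\<close> nonnegative on all of
      \<open>{0..T}\<close>, so that its gauge integral can be read as a nonnegative
      integral.\<close>
    define h where "h t = (if t \<in> N then 0 else q t + G' t)" for t
    have "q integrable_on {0..T}"
      by (rule set_lebesgue_integral_eq_integral(1)[OF set_integrable_subset[OF q_int]]) auto
    then obtain I where I: "(q has_integral I) {0..T}" by blast
    have "(G' has_integral (G T - G 0)) {0..T}"
      by (rule abs_cont_on_has_integral_derivative[OF T AC N])
        (rule has_field_derivative_at_within, rule der, auto)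
    with I have "((\<lambda>t. q t + G' t) has_integral (I + (G T - G 0))) {0..T}" by (rule has_integral_add)
    then have h: "(h has_integral (I + (G T - G 0))) {0..T}"
      by (rule has_integral_spike[OF N, rotated]) (auto simp: h_def)
    have h0: "0 \<le> h t" if "t \<in> {0..T}" for t
      using nonneg(1)[of t] le[of t] that by (auto simp: h_def)
    have "(\<integral>\<^sup>+t. ennreal (p t) * indicator {0..T} t \<partial>lebesgue)
       \<le> (\<integral>\<^sup>+t. ennreal (h t) * indicator {0..T} t \<partial>lebesgue)"
    proof (rule nn_integral_mono_AE)
      have "N \<in> null_sets lebesgue" using N by (simp add: negligible_iff_null_sets)
      then show "AE t in lebesgue. ennreal (p t) * indicator {0..T} t \<le> ennreal (h t) * indicator {0..T} t"
      proof (rule AE_I')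
        show "{t \<in> space lebesgue. \<not> ennreal (p t) * indicator {0..T} t \<le> ennreal (h t) * indicator {0..T} t} \<subseteq> N"
          using le by (auto simp: indicator_def h_def intro!: ennreal_leI)
      qed
    qed
    also have "\<dots> = ennreal (I + (G T - G 0))"
      unfolding nn_integral_completion by (rule nn_integral_has_integral_lebesgue'[OF h0 h])
    also have "\<dots> \<le> ennreal (I + C)" using C[OF T] by (intro ennreal_leI) simp
    also have "\<dots> = ennreal I + ennreal C"
      using has_integral_nonneg[OF I] nonneg(2) C0 by (intro ennreal_plus) auto
    also have "ennreal I = (\<integral>\<^sup>+t. ennreal (q t) * indicator {0..T} t \<partial>lborel)"
      using nonneg(2) by (intro nn_integral_has_integral_lebesgue'[OF _ I, symmetric]) auto
    also have "\<dots> \<le> (\<integral>\<^sup>+t. ennreal (q t) * indicator {0..} t \<partial>lborel)"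
      by (intro nn_integral_mono) (auto simp: indicator_def)
    finally show ?thesis by (simp only: add_right_mono)
  qed
  \<comment> \<open>Monotone convergence along the intervals \<open>{0..real k}\<close> reaches the
    half-line.\<close>
  let ?f = "\<lambda>(k::nat) t. ennreal (p t) * indicator {0..real k} t"
  have lim: "(SUP k. ?f k t) = ennreal (p t) * indicator {0..} t" for t
  proof (rule antisym)
    show "(SUP k. ?f k t) \<le> ennreal (p t) * indicator {0..} t"
      by (intro SUP_least) (auto simp: indicator_def)
    obtain k where "t \<le> real k" using real_arch_simple by blast
    then have "ennreal (p t) * indicator {0..} t \<le> ?f k t" by (auto simp: indicator_def)
    also have "\<dots> \<le> (SUP k. ?f k t)" by (intro SUP_upper) auto
    finally show "ennreal (p t) * indicator {0..} t \<le> (SUP k. ?f k t)" .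
  qed
  have "(\<integral>\<^sup>+t. ennreal (p t) * indicator {0..} t \<partial>lborel) = (\<integral>\<^sup>+t. (SUP k. ?f k t) \<partial>lebesgue)"
    unfolding lim nn_integral_completion ..
  also have "\<dots> = (SUP k. \<integral>\<^sup>+t. ?f k t \<partial>lebesgue)"
  proof (rule nn_integral_monotone_convergence_SUP)
    show "incseq ?f" by (auto simp: incseq_def le_fun_def indicator_def)
    fix k
    have "(\<lambda>t. ennreal (indicator {0..} t *\<^sub>R p t) * indicator {0..real k} t) \<in> borel_measurable lebesgue"
      by (intro borel_measurable_times_ennreal measurable_compose[OF meas[OF p] measurable_ennreal]
          borel_measurable_indicator) auto
    moreover have "(\<lambda>t. ennreal (indicator {0..} t *\<^sub>R p t) * indicator {0..real k} t) = ?f k"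
      by (auto simp: fun_eq_iff indicator_def)
    ultimately show "?f k \<in> borel_measurable lebesgue" by (simp only:)
  qed
  also have "\<dots> \<le> (\<integral>\<^sup>+t. ennreal (q t) * indicator {0..} t \<partial>lborel) + ennreal C"
    by (intro SUP_least bound) simp
  finally show ?thesis .
qed

section \<open>Measurability of derivatives and cost paths\<close>

lemma abs_cont_on_imp_continuous_on_halfline:
  assumes "\<And>T. abs_cont_on {0..T} f"
  shows "continuous_on {0..} f"
  unfolding continuous_on_eq_continuous_within
proof
  fix t :: real assume t: "t \<in> {0..}"
  have "at t within {0..} = at t within {0..t+1}"
    by (rule at_within_nhd[of t "{..<t+1}"]) auto
  moreover have "continuous (at t within {0..t+1}) f"
    using abs_cont_on_imp_continuous_on[OF assms] t by (auto simp: continuous_on_eq_continuous_within)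
  ultimately show "continuous (at t within {0..}) f" by simp
qed

text \<open>Off \<open>N\<close> the derivative is a limit of difference quotients, taken with
  positive steps so that they stay in the half-line. Completeness of Lebesgue measure then allows
  arbitrary values of \<open>deriv\<close> on \<open>N\<close>.\<close>

lemma borel_measurable_deriv:
  fixes f :: "real \<Rightarrow> real"
  assumes f: "continuous_on {0..} f" and N: "negligible N"
    and diff: "\<And>t. t \<in> {0..} - N \<Longrightarrow> f differentiable (at t)"
  shows "deriv f \<in> borel_measurable (lebesgue_on {0..})"
proof -
  define g where "g k t = (f (t + inverse (real (Suc k))) - f t) / inverse (real (Suc k))" for k t
  have lim: "(\<lambda>k. g k t) \<longlonglongrightarrow> deriv f t" if "t \<in> {0..} - N" for t
  proof -
    have "(f has_real_derivative deriv f t) (at t)"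
      using diff[OF that] by (simp add: DERIV_deriv_iff_real_differentiable)
    then have "(\<lambda>h. (f (t + h) - f t) / h) \<midarrow>0\<rightarrow> deriv f t" by (simp add: DERIV_def)
    moreover have "filterlim (\<lambda>k. inverse (real (Suc k))) (at 0) sequentially"
      using LIMSEQ_inverse_real_of_nat by (intro filterlim_atI) auto
    ultimately show ?thesis
      unfolding g_def by (rule filterlim_compose)
  qed
  have gm: "(\<lambda>t. if t \<in> {0..} then g k t else 0) \<in> borel_measurable lebesgue" for k
  proof (subst borel_measurable_if)
    have "continuous_on {0..} (g k)"
      unfolding g_def
      by (intro continuous_intros continuous_on_compose2[OF f] f) auto
    then show "g k \<in> borel_measurable (lebesgue_on {0..})"
      by (rule continuous_imp_measurable_on_sets_lebesgue) auto
  qed auto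
  define F where "F k t = (if t \<in> {0..} - N then g k t else 0)" for k t
  have NL: "N \<in> null_sets lebesgue" using N by (simp add: negligible_iff_null_sets)
  have Fm: "F k \<in> borel_measurable lebesgue" for k
    by (rule borel_measurable_AE[OF gm[of k]]) (rule AE_I'[OF NL], auto simp: F_def)
  have "(\<lambda>t. if t \<in> {0..} - N then deriv f t else 0) \<in> borel_measurable lebesgue"
  proof (rule borel_measurable_LIMSEQ_real[where u = F])
    show "(\<lambda>k. F k t) \<longlonglongrightarrow> (if t \<in> {0..} - N then deriv f t else 0)" for t
      using lim[of t] by (auto simp: F_def)
  qed (rule Fm)
  then have "(\<lambda>t. if t \<in> {0..} then deriv f t else 0) \<in> borel_measurable lebesgue"
    by (rule borel_measurable_AE) (rule AE_I'[OF NL], auto)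
  then show ?thesis by (subst (asm) borel_measurable_if) auto
qed

text \<open>On each bounded interval the path is continuous off a finite, hence null, set; the
  truncations to \<open>{0..real k}\<close> converge pointwise.\<close>

lemma piecewise_cont_path_measurable:
  assumes "piecewise_cont_path n c" "i < n"
  shows "(\<lambda>t. c t i) \<in> borel_measurable (lebesgue_on {0..})"
proof -
  have "(\<lambda>t. if t \<in> {0..real k} then c t i else 0) \<in> borel_measurable lebesgue" for k
  proof -
    obtain D where D: "finite D" "continuous_on ({0..real k} - D) (\<lambda>t. c t i)"
      using assms unfolding piecewise_cont_path_def by blast
    have DL: "D \<in> null_sets lebesgue"
      using D(1) negligible_finite negligible_iff_null_sets by blast
    have "(\<lambda>t. if t \<in> {0..real k} - D then c t i else 0) \<in> borel_measurable lebesgue"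
      using DL by (subst borel_measurable_if)
        (auto intro!: continuous_imp_measurable_on_sets_lebesgue[OF D(2)])
    then show ?thesis
      by (rule borel_measurable_AE) (rule AE_I'[OF DL], auto)
  qed
  then have "(\<lambda>t. if t \<in> {0..} then c t i else 0) \<in> borel_measurable lebesgue"
  proof (rule borel_measurable_LIMSEQ_real[rotated])
    fix t :: real
    obtain k0 where k0: "t \<le> real k0" using real_arch_simple by blast
    have "\<forall>\<^sub>F k in sequentially. (if t \<in> {0..real k} then c t i else 0) = (if t \<in> {0..} then c t i else 0)"
      using eventually_ge_at_top[of k0] by eventually_elim (use k0 in auto)
    then show "(\<lambda>k. if t \<in> {0..real k} then c t i else 0) \<longlonglongrightarrow> (if t \<in> {0..} then c t i else 0)"
      by (rule tendsto_eventually)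
  qed
  then show ?thesis by (subst (asm) borel_measurable_if) auto
qed

section \<open>Pointwise estimates\<close>

text \<open>Since \<delta> \<le> 1/2, one has
  \<open>u + \<delta> \<le> 1 + \<delta> \<le> 1/\<delta>\<close>, while
  \<open>v + \<delta> \<ge> \<delta>\<close>; each logarithm costs one
  \<open>ln (1/\<delta>)\<close>.\<close>

lemma ln_shift_diff_le:
  fixes \<delta> u v :: real
  assumes "0 < \<delta>" "\<delta> \<le> 1/2" "0 \<le> u" "u \<le> 1" "0 \<le> v"
  shows "ln (u + \<delta>) - ln (v + \<delta>) \<le> 2 * ln (1/\<delta>)"
proof -
  have "\<delta> * \<delta> \<le> 1/2 * (1/2)" using assms by (intro mult_mono) auto
  then have "\<delta> * (1 + \<delta>) \<le> 1" using assms by (simp add: algebra_simps)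
  then have "1 + \<delta> \<le> 1 / \<delta>" using assms by (simp add: field_simps)
  then have "ln (u + \<delta>) \<le> ln (1 / \<delta>)" using assms by (intro ln_mono) auto
  moreover have "ln \<delta> \<le> ln (v + \<delta>)" using assms by (intro ln_mono) auto
  moreover have "ln (1 / \<delta>) = - ln \<delta>" using assms by (simp add: ln_div)
  ultimately show ?thesis by linarith
qed

text \<open>This is a summand of the Bregman divergence of the entropy;
  \<open>ln z \<le> z - 1\<close> at \<open>z = b / a\<close> gives the sign.\<close>

lemma bregman_term_nonneg:
  fixes a b :: real
  assumes "0 < a" "0 < b"
  shows "0 \<le> a * (ln a - ln b) - (a - b)"
proof -
  have "ln (b / a) \<le> b / a - 1" using assms by (intro ln_le_minus_one) auto
  then have "a * ln (b / a) \<le> a * (b / a - 1)" using assms by (intro mult_left_mono) auto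
  then show ?thesis using assms by (simp add: ln_div algebra_simps)
qed

text \<open>In \<open>y\<close> only the difference of the logarithms survives, since
  \<open>y'\<close> from the product rule cancels the linear term. In \<open>x\<close> the factor is
  \<open>1 - (y + \<delta>) / (x + \<delta>)\<close>.\<close>

lemma bregman_term_deriv:
  fixes x y :: "real \<Rightarrow> real"
  assumes "(x has_real_derivative x') (at t)" "(y has_real_derivative y') (at t)"
    and "0 < x t + \<delta>" "0 < y t + \<delta>"
  shows "((\<lambda>s. (y s + \<delta>) * (ln (y s + \<delta>) - ln (x s + \<delta>)) - (y s - x s)) has_real_derivative
    (y' * (ln (y t + \<delta>) - ln (x t + \<delta>)) + x' * (x t - y t) / (x t + \<delta>))) (at t)"
proof -
  have dx: "((\<lambda>s. x s + \<delta>) has_real_derivative x') (at t)" and dy: "((\<lambda>s. y s + \<delta>) has_real_derivative y') (at t)"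
    using DERIV_add[OF assms(1) DERIV_const[of \<delta>]] DERIV_add[OF assms(2) DERIV_const[of \<delta>]] by simp_all
  have lnx: "((\<lambda>s. ln (x s + \<delta>)) has_real_derivative x' / (x t + \<delta>)) (at t)"
    using DERIV_chain2[OF DERIV_ln_divide[OF assms(3)] dx] by simp
  have lny: "((\<lambda>s. ln (y s + \<delta>)) has_real_derivative y' / (y t + \<delta>)) (at t)"
    using DERIV_chain2[OF DERIV_ln_divide[OF assms(4)] dy] by simp
  have alg: "b * (y' / b - x' / a) + y' * l - (y' - x') = y' * l + x' * (a - b) / a"
    if "0 < a" "0 < b" for a b l :: real
    using that by (simp add: field_simps)
  from DERIV_diff[OF DERIV_mult'[OF dy DERIV_diff[OF lny lnx]] DERIV_diff[OF assms(2,1)]]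
  show ?thesis
    unfolding alg[OF assms(3,4)] by simp
qed

lemma in_simplex_le_1:
  assumes "in_simplex n z" "i < n"
  shows "z i \<le> 1"
  using member_le_sum[of i "{..<n}" z] assms by (auto simp: in_simplex_def)

text \<open>At a fixed time, with \<open>X'\<close> and \<open>Y'\<close> as velocities, the last
  sum is the derivative of the Bregman divergence. The logarithm estimate controls its
  \<open>Y'\<close> part and the dynamics its \<open>X'\<close> part.\<close>

lemma service_rate_bound:
  fixes X Y X' Y' w c \<xi> :: "nat \<Rightarrow> real"
  assumes X: "in_simplex n X" and Y: "in_simplex n Y" and w: "\<And>i. i < n \<Longrightarrow> 0 < w i"
    and \<eta>: "0 < \<eta>" and \<delta>: "0 < \<delta>" "\<delta> \<le> 1/2"
    and X': "\<And>i. i < n \<Longrightarrow> X' i = \<eta> / w i * (X i + \<delta>) * (\<mu> - c i + \<xi> i)"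
    and \<xi>: "\<And>i. i < n \<Longrightarrow> 0 \<le> \<xi> i \<and> (0 < \<xi> i \<longrightarrow> X i = 0)"
  shows "(\<Sum>i<n. c i * X i) \<le> (\<Sum>i<n. c i * Y i) + 2 * ln (1/\<delta>) / \<eta> * wnorm n w Y'
    - (\<Sum>i<n. w i / \<eta> * (Y' i * (ln (Y i + \<delta>) - ln (X i + \<delta>)) + X' i * (X i - Y i) / (X i + \<delta>)))"
proof -
  have summand: "w i / \<eta> * (Y' i * (ln (Y i + \<delta>) - ln (X i + \<delta>)) + X' i * (X i - Y i) / (X i + \<delta>))
    \<le> 2 * ln (1/\<delta>) / \<eta> * (w i * \<bar>Y' i\<bar>) + \<mu> * (X i - Y i) - c i * X i + c i * Y i" if i: "i < n" for i
  proof -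
    have b: "0 \<le> X i" "X i \<le> 1" "0 \<le> Y i" "Y i \<le> 1"
      using X Y in_simplex_le_1 i by (auto simp: in_simplex_def)
    have "\<bar>ln (Y i + \<delta>) - ln (X i + \<delta>)\<bar> \<le> 2 * ln (1/\<delta>)"
      using ln_shift_diff_le[OF \<delta>, of "Y i" "X i"] ln_shift_diff_le[OF \<delta>, of "X i" "Y i"] b by auto
    then have "Y' i * (ln (Y i + \<delta>) - ln (X i + \<delta>)) \<le> \<bar>Y' i\<bar> * (2 * ln (1/\<delta>))"
      by - (rule order_trans[OF abs_ge_self], simp add: abs_mult mult_left_mono)
    then have "w i / \<eta> * (Y' i * (ln (Y i + \<delta>) - ln (X i + \<delta>))) \<le> w i / \<eta> * (\<bar>Y' i\<bar> * (2 * ln (1/\<delta>)))"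
      using w[OF i] \<eta> by (intro mult_left_mono) auto
    also have "\<dots> = 2 * ln (1/\<delta>) / \<eta> * (w i * \<bar>Y' i\<bar>)" by simp
    finally have 1: "w i / \<eta> * (Y' i * (ln (Y i + \<delta>) - ln (X i + \<delta>))) \<le> 2 * ln (1/\<delta>) / \<eta> * (w i * \<bar>Y' i\<bar>)" .
    \<comment> \<open>The dynamics carries the inverse Hessian of the regularizer, which cancels the
      Hessian here.\<close>
    have "w i / \<eta> * (X' i * (X i - Y i) / (X i + \<delta>)) = (\<mu> - c i + \<xi> i) * (X i - Y i)"
    proof -
      have "v / \<eta> * (\<eta> / v * a * m * d / a) = m * d" if "0 < v" "0 < a" for v a m d :: real
        using that \<eta> by simp
      from this[of "w i" "X i + \<delta>"] show ?thesis
        unfolding X'[OF i] using w[OF i] \<delta> b by simp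
    qed
    \<comment> \<open>If \<open>\<xi> i > 0\<close>, then \<open>X i = 0\<close> and the difference
      is \<open>- Y i\<close>.\<close>
    moreover have "\<xi> i * (X i - Y i) \<le> 0"
      using \<xi>[OF i] b by (cases "0 < \<xi> i") (auto simp: mult_nonneg_nonpos)
    ultimately have "w i / \<eta> * (X' i * (X i - Y i) / (X i + \<delta>)) \<le> \<mu> * (X i - Y i) - c i * X i + c i * Y i"
      by (simp add: algebra_simps)
    with 1 show ?thesis by (simp add: distrib_left)
  qed
  have "(\<Sum>i<n. w i / \<eta> * (Y' i * (ln (Y i + \<delta>) - ln (X i + \<delta>)) + X' i * (X i - Y i) / (X i + \<delta>)))
    \<le> (\<Sum>i<n. 2 * ln (1/\<delta>) / \<eta> * (w i * \<bar>Y' i\<bar>) + \<mu> * (X i - Y i) - c i * X i + c i * Y i)"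
    using summand by (intro sum_mono) auto
  also have "\<dots> = 2 * ln (1/\<delta>) / \<eta> * wnorm n w Y' + \<mu> * ((\<Sum>i<n. X i) - (\<Sum>i<n. Y i))
      - (\<Sum>i<n. c i * X i) + (\<Sum>i<n. c i * Y i)"
    by (simp only: wnorm_def sum.distrib sum_subtractf sum_distrib_left[symmetric])
  finally show ?thesis using X Y by (simp add: in_simplex_def)
qed

text \<open>Movement is charged to service through
  \<open>\<bar>z\<bar> \<le> z + 2 * \<eta> * c i\<close>, which needs \<mu> \<ge> 0. The last sum
  is the derivative of a potential combining the weighted mass and the weighted logarithms; its
  coefficients make the estimate close exactly.\<close>

lemma movement_rate_bound:
  fixes X X' w c :: "nat \<Rightarrow> real"
  assumes X: "in_simplex n X" and w: "\<And>i. i < n \<Longrightarrow> 0 < w i"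
    and \<eta>: "0 < \<eta>" and \<delta>: "0 < \<delta>"
    and c: "\<And>i. i < n \<Longrightarrow> 0 \<le> c i"
    and sum0: "(\<Sum>i<n. X' i) = 0"
    and zero: "\<And>i. i < n \<Longrightarrow> X i = 0 \<Longrightarrow> X' i = 0"
    and pos: "\<And>i. i < n \<Longrightarrow> 0 < X i \<Longrightarrow> X' i = \<eta> / w i * (X i + \<delta>) * (\<mu> - c i)"
  shows "wnorm n w X' \<le> 2 * \<eta> * (1 + \<delta> * real n) * (\<Sum>i<n. c i * X i)
    + (\<Sum>i<n. w i * ((1 + 2 * \<delta> * real n) * X' i - 2 * \<delta> * (1 + \<delta> * real n) * (X' i / (X i + \<delta>))))"
proof -
  have X0: "0 \<le> X i" if "i < n" for i using X that by (auto simp: in_simplex_def)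
  \<comment> \<open>For negative \<mu> every positive coordinate would strictly decrease, against
    conservation of mass.\<close>
  have \<mu>: "0 \<le> \<mu>"
  proof (rule ccontr)
    assume "\<not> 0 \<le> \<mu>"
    have neg: "X' i < 0" if i: "i < n" "0 < X i" for i
      unfolding pos[OF i] using w[OF i(1)] c[OF i(1)] i(2) \<delta> \<eta> \<open>\<not> 0 \<le> \<mu>\<close>
      by (intro mult_pos_neg mult_pos_pos divide_pos_pos) auto
    obtain j where j: "j < n" "0 < X j"
      using X X0 by (metis in_simplex_def lessThan_iff less_eq_real_def sum.neutral zero_neq_one)
    have "(\<Sum>i<n. X' i) < (\<Sum>i<n. 0)"
    proof (rule sum_strict_mono_ex1)
      show "\<forall>i\<in>{..<n}. X' i \<le> 0"
        using neg zero X0 by (metis lessThan_iff less_eq_real_def)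
      show "\<exists>i\<in>{..<n}. X' i < 0" using neg j by auto
    qed simp
    then show False using sum0 by simp
  qed
  \<comment> \<open>The correction term involving \<open>\<mu>\<close> sums to \<open>0\<close> and is what makes the estimate hold for each summand.\<close>
  have summand: "w i * \<bar>X' i\<bar> \<le> 2 * \<eta> * (1 + \<delta> * real n) * (c i * X i)
    + w i * ((1 + 2 * \<delta> * real n) * X' i - 2 * \<delta> * (1 + \<delta> * real n) * (X' i / (X i + \<delta>)))
    - 2 * \<delta> * \<eta> * \<mu> * (real n * X i - 1)" if i: "i < n" for i
  proof (cases "X i = 0")
    \<comment> \<open>Here only the correction term survives; it equals
      \<open>2 * \<delta> * \<eta> * \<mu>\<close>, which is nonnegative.\<close>
    case True
    then show ?thesis using zero[OF i True] \<mu> \<eta> \<delta> by simp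
  next
    case False
    then have Xi: "0 < X i" using X0[OF i] by simp
    \<comment> \<open>\<open>z\<close> is the contribution of coordinate \<open>i\<close> to the
      derivative of the weighted logarithms.\<close>
    define z where "z = \<eta> * (\<mu> - c i)"
    have wX: "w i * X' i = (X i + \<delta>) * z"
      unfolding pos[OF i Xi] z_def using w[OF i] by simp
    then have wXd: "w i * (X' i / (X i + \<delta>)) = z"
      using Xi \<delta> by (simp add: field_simps)
    have "w i * \<bar>X' i\<bar> = \<bar>w i * X' i\<bar>" using w[OF i] by (simp add: abs_mult)
    also have "\<dots> = (X i + \<delta>) * \<bar>z\<bar>" unfolding wX using Xi \<delta> by (simp add: abs_mult)
    also have "\<dots> \<le> (X i + \<delta>) * (z + 2 * \<eta> * c i)"
    proof (rule mult_left_mono)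
      have "0 \<le> \<eta> * \<mu>" "0 \<le> \<eta> * c i" using \<eta> \<mu> c[OF i] by auto
      then show "\<bar>z\<bar> \<le> z + 2 * \<eta> * c i" by (simp add: z_def abs_le_iff algebra_simps)
    qed (use Xi \<delta> in simp)
    \<comment> \<open>The part \<open>2 * \<eta> * \<delta> * c i\<close>, which has no factor
      \<open>X i\<close>, equals \<open>2 * \<delta> * (\<eta> * \<mu> - z)\<close>. The
      coefficients are chosen so that absorbing it leaves an identity.\<close>
    also have "\<dots> = 2 * \<eta> * (1 + \<delta> * real n) * (c i * X i)
      + ((1 + 2 * \<delta> * real n) * ((X i + \<delta>) * z) - 2 * \<delta> * (1 + \<delta> * real n) * z)
      - 2 * \<delta> * \<eta> * \<mu> * (real n * X i - 1)"
      by (simp add: z_def algebra_simps)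
    also have "\<dots> = 2 * \<eta> * (1 + \<delta> * real n) * (c i * X i)
    + w i * ((1 + 2 * \<delta> * real n) * X' i - 2 * \<delta> * (1 + \<delta> * real n) * (X' i / (X i + \<delta>)))
    - 2 * \<delta> * \<eta> * \<mu> * (real n * X i - 1)"
    proof -
      have "w i * (\<alpha> * X' i - \<beta> * (X' i / (X i + \<delta>))) = \<alpha> * (w i * X' i) - \<beta> * (w i * (X' i / (X i + \<delta>)))" for \<alpha> \<beta>
        by (simp only: right_diff_distrib mult.left_commute)
      then show ?thesis unfolding wX wXd by simp
    qed
    finally show ?thesis .
  qed
  have "wnorm n w X' \<le> (\<Sum>i<n. 2 * \<eta> * (1 + \<delta> * real n) * (c i * X i)
    + w i * ((1 + 2 * \<delta> * real n) * X' i - 2 * \<delta> * (1 + \<delta> * real n) * (X' i / (X i + \<delta>)))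
    - 2 * \<delta> * \<eta> * \<mu> * (real n * X i - 1))"
    unfolding wnorm_def using summand by (intro sum_mono) auto
  also have "\<dots> = 2 * \<eta> * (1 + \<delta> * real n) * (\<Sum>i<n. c i * X i)
    + (\<Sum>i<n. w i * ((1 + 2 * \<delta> * real n) * X' i - 2 * \<delta> * (1 + \<delta> * real n) * (X' i / (X i + \<delta>))))
    - 2 * \<delta> * \<eta> * \<mu> * (real n * (\<Sum>i<n. X i) - (\<Sum>i<n. 1))"
    by (simp only: sum.distrib sum_subtractf sum_distrib_left[symmetric])
  also have "(\<Sum>i<n. X i) = 1" using X by (simp add: in_simplex_def)
  finally show ?thesis by simp
qed

text \<open>The difference \<open>D\<close> of logarithms is bounded both by
  \<open>2 * ln (1/\<delta>)\<close> and by \<open>Z i / \<delta>\<close>. The second bound absorbs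
  the term quadratic in \<delta>, so only \<open>2 * \<delta> * D\<close> costs a logarithm in each
  coordinate.\<close>

lemma movement_potential_bound:
  fixes X Z w :: "nat \<Rightarrow> real"
  assumes X: "in_simplex n X" and Z: "in_simplex n Z" and n: "0 < n"
    and w: "\<And>i. i < n \<Longrightarrow> 0 < w i" and \<delta>: "0 < \<delta>" "\<delta> \<le> 1/2"
  shows "(\<Sum>i<n. w i * ((1 + 2 * \<delta> * real n) * X i - 2 * \<delta> * (1 + \<delta> * real n) * ln (X i + \<delta>)))
    - (\<Sum>i<n. w i * ((1 + 2 * \<delta> * real n) * Z i - 2 * \<delta> * (1 + \<delta> * real n) * ln (Z i + \<delta>)))
    \<le> (1 + 8 * \<delta> * real n * ln (1/\<delta>)) * Max (w ` {..<n})"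
proof -
  define W where "W = Max (w ` {..<n})"
  have wW: "w i \<le> W" if "i < n" for i using that by (auto simp: W_def)
  have W0: "0 \<le> W" using wW[OF n] w[OF n] by simp
  \<comment> \<open>The resulting bound \<open>1/2 \<le> ln (1/\<delta>)\<close> lets
    \<open>2 * \<delta> * real n\<close> be absorbed into the logarithmic term at the end.\<close>
  have "ln (2::real) \<le> ln (1/\<delta>)" using \<delta> by (intro ln_mono) (auto simp: field_simps)
  moreover have "1/2 \<le> ln (2::real)" using ln_le_minus_one[of "1/2::real"] by (simp add: ln_div)
  ultimately have l: "1/2 \<le> ln (1/\<delta>)" by simp
  have summand: "w i * ((1 + 2 * \<delta> * real n) * X i - 2 * \<delta> * (1 + \<delta> * real n) * ln (X i + \<delta>))
    - w i * ((1 + 2 * \<delta> * real n) * Z i - 2 * \<delta> * (1 + \<delta> * real n) * ln (Z i + \<delta>))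
    \<le> W * ((1 + 2 * \<delta> * real n) * X i + 4 * \<delta> * ln (1/\<delta>))" if i: "i < n" for i
  proof -
    have b: "0 \<le> X i" "X i \<le> 1" "0 \<le> Z i" "Z i \<le> 1"
      using X Z in_simplex_le_1 i by (auto simp: in_simplex_def)
    define D where "D = ln (Z i + \<delta>) - ln (X i + \<delta>)"
    have D1: "D \<le> 2 * ln (1/\<delta>)" unfolding D_def using ln_shift_diff_le[OF \<delta>, of "Z i" "X i"] b by auto
    have "ln \<delta> \<le> ln (X i + \<delta>)" using \<delta> b by (intro ln_mono) auto
    then have "D \<le> ln ((Z i + \<delta>) / \<delta>)" using \<delta> b by (simp add: D_def ln_div)
    also have "\<dots> \<le> (Z i + \<delta>) / \<delta> - 1" using \<delta> b by (intro ln_le_minus_one) auto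
    finally have D2: "\<delta> * D \<le> Z i" using \<delta> by (simp add: field_simps)
    have "(1 + 2 * \<delta> * real n) * X i - 2 * \<delta> * (1 + \<delta> * real n) * ln (X i + \<delta>)
      - ((1 + 2 * \<delta> * real n) * Z i - 2 * \<delta> * (1 + \<delta> * real n) * ln (Z i + \<delta>))
      = (1 + 2 * \<delta> * real n) * X i - Z i + 2 * \<delta> * real n * (\<delta> * D - Z i) + 2 * \<delta> * D"
      by (simp add: D_def algebra_simps)
    also have "\<dots> \<le> (1 + 2 * \<delta> * real n) * X i + 4 * \<delta> * ln (1/\<delta>)"
    proof -
      have "2 * \<delta> * real n * (\<delta> * D - Z i) \<le> 0" using D2 \<delta> by (intro mult_nonneg_nonpos) auto
      moreover have "2 * \<delta> * D \<le> 2 * \<delta> * (2 * ln (1/\<delta>))" using D1 \<delta> by (intro mult_left_mono) auto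
      ultimately show ?thesis using b by linarith
    qed
    finally have "w i * ((1 + 2 * \<delta> * real n) * X i - 2 * \<delta> * (1 + \<delta> * real n) * ln (X i + \<delta>)
      - ((1 + 2 * \<delta> * real n) * Z i - 2 * \<delta> * (1 + \<delta> * real n) * ln (Z i + \<delta>)))
      \<le> w i * ((1 + 2 * \<delta> * real n) * X i + 4 * \<delta> * ln (1/\<delta>))"
      using w[OF i] by (intro mult_left_mono) auto
    \<comment> \<open>The bracket is now nonnegative, so the weight may be replaced by the maximum;
      summing over \<open>X i\<close> then uses total mass 1.\<close>
    also have "\<dots> \<le> W * ((1 + 2 * \<delta> * real n) * X i + 4 * \<delta> * ln (1/\<delta>))"
      using wW[OF i] b \<delta> l by (intro mult_right_mono add_nonneg_nonneg mult_nonneg_nonneg) auto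
    finally show ?thesis by (simp only: right_diff_distrib)
  qed
  have "(\<Sum>i<n. w i * ((1 + 2 * \<delta> * real n) * X i - 2 * \<delta> * (1 + \<delta> * real n) * ln (X i + \<delta>)))
    - (\<Sum>i<n. w i * ((1 + 2 * \<delta> * real n) * Z i - 2 * \<delta> * (1 + \<delta> * real n) * ln (Z i + \<delta>)))
    \<le> (\<Sum>i<n. W * ((1 + 2 * \<delta> * real n) * X i + 4 * \<delta> * ln (1/\<delta>)))"
    unfolding sum_subtractf[symmetric] using summand by (intro sum_mono) auto
  also have "\<dots> = W * ((1 + 2 * \<delta> * real n) * (\<Sum>i<n. X i) + real n * (4 * \<delta> * ln (1/\<delta>)))"
    by (simp add: sum.distrib sum_distrib_left[symmetric])
  also have "\<dots> = W * (1 + 2 * \<delta> * real n + 4 * \<delta> * real n * ln (1/\<delta>))"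
    using X by (simp add: in_simplex_def)
  also have "\<dots> \<le> W * (1 + 8 * \<delta> * real n * ln (1/\<delta>))"
  proof (rule mult_left_mono[OF _ W0])
    have "4 * \<delta> * real n * (1/2) \<le> 4 * \<delta> * real n * ln (1/\<delta>)" using l \<delta> by (intro mult_left_mono) auto
    then show "1 + 2 * \<delta> * real n + 4 * \<delta> * real n * ln (1/\<delta>) \<le> 1 + 8 * \<delta> * real n * ln (1/\<delta>)" by simp
  qed
  finally show ?thesis by (simp add: W_def mult.commute)
qed

section \<open>Entropic mirror descent\<close>

text \<open>Combines the exceptional sets for the intervals from 0 to \<open>real k\<close>; the
  endpoint 0 is left out because the derivatives are two-sided.\<close>

lemma abs_cont_halfline_differentiable_AE:
  assumes "\<And>T. abs_cont_on {0..T} f"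
  obtains N where "negligible N" "\<And>t. 0 < t \<Longrightarrow> t \<notin> N \<Longrightarrow> f differentiable (at t)"
proof -
  have "\<exists>N. negligible N \<and> (\<forall>t\<in>{0<..<real k} - N. f differentiable (at t))" for k
  proof (rule abs_cont_on_differentiable_AE[OF assms[of "real k"]])
    fix N assume "negligible N" "\<And>t. t \<in> {0<..<real k} - N \<Longrightarrow> f differentiable (at t)"
    then show ?thesis by blast
  qed
  then obtain N where N: "\<And>k. negligible (N k)"
    "\<And>k t. t \<in> {0<..<real k} - N k \<Longrightarrow> f differentiable (at t)" by metis
  show thesis
  proof (rule that[of "\<Union>k. N k"])
    show "negligible (\<Union>k. N k)" using N(1) by (intro negligible_countable_Union) auto
    fix t :: real assume t: "0 < t" "t \<notin> (\<Union>k. N k)"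
    obtain k where "t < real k" using reals_Archimedean2 by blast
    then show "f differentiable (at t)" using N(2)[of t k] t by auto
  qed
qed

text \<open>Collects one null set off which all pointwise arguments apply. It contains 0, so that
  derivatives within the half-line become two-sided. Differentiability of \<open>x\<close> comes
  from its equation, that of \<open>y\<close> from absolute continuity.\<close>

lemma setting_regular_points:
  assumes S: "setting n w \<eta> \<delta> c x y"
  obtains N \<mu> \<xi> where "negligible N" "0 \<in> N"
    "\<And>t i. t \<in> {0..} - N \<Longrightarrow> i < n \<Longrightarrow> ((\<lambda>s. x s i) has_real_derivative
        (\<eta> / w i * (x t i + \<delta>) * (\<mu> t - c t i + \<xi> t i))) (at t)"
    "\<And>t i. t \<in> {0..} - N \<Longrightarrow> i < n \<Longrightarrow> (\<lambda>s. y s i) differentiable (at t)"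
    "\<And>t i. 0 \<le> t \<Longrightarrow> i < n \<Longrightarrow> 0 \<le> \<xi> t i \<and> (0 < \<xi> t i \<longrightarrow> x t i = 0)"
proof -
  have "emd_path n w \<eta> \<delta> c x" using S by (simp add: setting_def)
  then obtain \<mu> \<xi> where \<xi>: "\<forall>t\<ge>0. \<forall>i<n. 0 \<le> \<xi> t i \<and> (0 < \<xi> t i \<longrightarrow> x t i = 0)"
    and AE: "AE t in lborel. 0 \<le> t \<longrightarrow> (\<forall>i<n. ((\<lambda>s. x s i) has_real_derivative
                (\<eta> / w i * (x t i + \<delta>) * (\<mu> t - c t i + \<xi> t i))) (at t within {0..}))"
    unfolding emd_path_def by (elim conjE exE) (rule that; assumption)
  define P where "P t \<longleftrightarrow> (0 \<le> t \<longrightarrow> (\<forall>i<n. ((\<lambda>s. x s i) has_real_derivative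
                (\<eta> / w i * (x t i + \<delta>) * (\<mu> t - c t i + \<xi> t i))) (at t within {0..})))" for t
  have "AE t in lborel. P t" unfolding P_def by (rule AE)
  then obtain N1 where N1: "N1 \<in> null_sets lborel" "\<And>t. t \<notin> N1 \<Longrightarrow> P t"
    unfolding eventually_ae_filter by auto
  have "negligible N1"
    unfolding negligible_iff_null_sets using N1(1) by (rule null_sets_completionI)
  have "\<exists>N. negligible N \<and> (\<forall>t. 0 < t \<longrightarrow> t \<notin> N \<longrightarrow> (\<lambda>s. y s i) differentiable (at t))" if "i < n" for i
  proof -
    have AC: "abs_cont_on {0..T} (\<lambda>s. y s i)" for T
      using S that by (auto simp: setting_def abs_cont_path_def)
    show ?thesis
    proof (rule abs_cont_halfline_differentiable_AE[OF AC])
      fix N assume "negligible N" "\<And>t. 0 < t \<Longrightarrow> t \<notin> N \<Longrightarrow> (\<lambda>s. y s i) differentiable (at t)"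
      then show ?thesis by blast
    qed
  qed
  then obtain M where M: "\<And>i. i < n \<Longrightarrow> negligible (M i)"
    "\<And>i t. i < n \<Longrightarrow> 0 < t \<Longrightarrow> t \<notin> M i \<Longrightarrow> (\<lambda>s. y s i) differentiable (at t)" by metis
  define N where "N = {0} \<union> N1 \<union> (\<Union>i<n. M i)"
  show thesis
  proof (rule that[of N \<mu> \<xi>])
    have "negligible (\<Union>i<n. M i)" using M(1) by (intro negligible_Union) auto
    then show "negligible N" using \<open>negligible N1\<close> by (simp add: N_def)
    show "0 \<in> N" by (simp add: N_def)
    fix t i assume t: "t \<in> {0..} - N" and i: "i < n"
    then have t0: "0 < t" "t \<notin> M i" "t \<notin> N1" by (auto simp: N_def less_eq_real_def)
    then show "(\<lambda>s. y s i) differentiable (at t)" using M(2) i by blast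
    have "at t within {0..} = at t" using t0(1) by (intro at_within_interior) simp
    moreover have "((\<lambda>s. x s i) has_real_derivative
        (\<eta> / w i * (x t i + \<delta>) * (\<mu> t - c t i + \<xi> t i))) (at t within {0..})"
      using N1(2)[OF t0(3)] t0(1) i unfolding P_def by simp
    ultimately show "((\<lambda>s. x s i) has_real_derivative
        (\<eta> / w i * (x t i + \<delta>) * (\<mu> t - c t i + \<xi> t i))) (at t)" by (simp only:)
  qed (use \<xi> in auto)
qed

lemma setting_measurable:
  assumes S: "setting n w \<eta> \<delta> c x y"
  shows "(\<lambda>t. \<Sum>i<n. c t i * x t i) \<in> borel_measurable (lebesgue_on {0..})"
    and "(\<lambda>t. \<Sum>i<n. c t i * y t i) \<in> borel_measurable (lebesgue_on {0..})"
    and "(\<lambda>t. wnorm n w (\<lambda>i. deriv (\<lambda>s. x s i) t)) \<in> borel_measurable (lebesgue_on {0..})"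
    and "(\<lambda>t. wnorm n w (\<lambda>i. deriv (\<lambda>s. y s i) t)) \<in> borel_measurable (lebesgue_on {0..})"
proof -
  obtain N \<mu> \<xi> where N: "negligible N"
    and dx: "\<And>t i. t \<in> {0..} - N \<Longrightarrow> i < n \<Longrightarrow> ((\<lambda>s. x s i) has_real_derivative
        (\<eta> / w i * (x t i + \<delta>) * (\<mu> t - c t i + \<xi> t i))) (at t)"
    and dy: "\<And>t i. t \<in> {0..} - N \<Longrightarrow> i < n \<Longrightarrow> (\<lambda>s. y s i) differentiable (at t)"
    using setting_regular_points[OF S] by metis
  have dx': "(\<lambda>s. x s i) differentiable (at t)" if "t \<in> {0..} - N" "i < n" for t i
    using dx[OF that] real_differentiable_def by blast
  have cont: "continuous_on {0..} (\<lambda>s. x s i)" "continuous_on {0..} (\<lambda>s. y s i)" if "i < n" for i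
    using S that
    by (auto simp: setting_def emd_path_def abs_cont_path_def intro!: abs_cont_on_imp_continuous_on_halfline)
  have cm: "(\<lambda>t. c t i) \<in> borel_measurable (lebesgue_on {0..})" if "i < n" for i
    using S that by (intro piecewise_cont_path_measurable) (auto simp: setting_def)
  have xm: "(\<lambda>t. x t i) \<in> borel_measurable (lebesgue_on {0..})"
    "(\<lambda>t. y t i) \<in> borel_measurable (lebesgue_on {0..})" if "i < n" for i
    using cont[OF that] by (auto intro: continuous_imp_measurable_on_sets_lebesgue)
  have dm: "deriv (\<lambda>s. x s i) \<in> borel_measurable (lebesgue_on {0..})"
    "deriv (\<lambda>s. y s i) \<in> borel_measurable (lebesgue_on {0..})" if "i < n" for i
    using borel_measurable_deriv[OF cont(1)[OF that] N dx'] borel_measurable_deriv[OF cont(2)[OF that] N dy] that by auto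
  show "(\<lambda>t. \<Sum>i<n. c t i * x t i) \<in> borel_measurable (lebesgue_on {0..})"
    "(\<lambda>t. \<Sum>i<n. c t i * y t i) \<in> borel_measurable (lebesgue_on {0..})"
    using cm xm by (auto intro!: borel_measurable_sum borel_measurable_times)
  show "(\<lambda>t. wnorm n w (\<lambda>i. deriv (\<lambda>s. x s i) t)) \<in> borel_measurable (lebesgue_on {0..})"
    "(\<lambda>t. wnorm n w (\<lambda>i. deriv (\<lambda>s. y s i) t)) \<in> borel_measurable (lebesgue_on {0..})"
    unfolding wnorm_def using dm
    by (auto intro!: borel_measurable_sum borel_measurable_times borel_measurable_abs)
qed

text \<open>Linearity requires measurability, which is given in the completed sense; hence the
  passage through \<open>lebesgue\<close>, which leaves the integrals unchanged.\<close>

lemma nn_integral_halfline_add_cmult: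
  fixes p q :: "real \<Rightarrow> real"
  assumes p: "p \<in> borel_measurable (lebesgue_on {0..})" and q: "q \<in> borel_measurable (lebesgue_on {0..})"
    and nonneg: "\<And>t. 0 \<le> t \<Longrightarrow> 0 \<le> p t" "\<And>t. 0 \<le> t \<Longrightarrow> 0 \<le> q t" and k: "0 \<le> k"
  shows "(\<integral>\<^sup>+t. ennreal (p t + k * q t) * indicator {0..} t \<partial>lborel)
    = (\<integral>\<^sup>+t. ennreal (p t) * indicator {0..} t \<partial>lborel) + ennreal k * (\<integral>\<^sup>+t. ennreal (q t) * indicator {0..} t \<partial>lborel)"
proof -
  have meas: "(\<lambda>t. ennreal (f t) * indicator {0..} t) \<in> borel_measurable lebesgue"
    if "f \<in> borel_measurable (lebesgue_on {0..})" for f :: "real \<Rightarrow> real"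
  proof -
    have "(\<lambda>t. if t \<in> {0..} then f t else 0) \<in> borel_measurable lebesgue"
      using that by (subst borel_measurable_if) auto
    then have "(\<lambda>t. ennreal (if t \<in> {0..} then f t else 0)) \<in> borel_measurable lebesgue"
      by (rule measurable_compose[OF _ measurable_ennreal])
    moreover have "(\<lambda>t. ennreal (if t \<in> {0..} then f t else 0)) = (\<lambda>t. ennreal (f t) * indicator {0..} t)"
      by (auto simp: fun_eq_iff)
    ultimately show ?thesis by (simp only:)
  qed
  have "(\<integral>\<^sup>+t. ennreal (p t + k * q t) * indicator {0..} t \<partial>lebesgue)
    = (\<integral>\<^sup>+t. ennreal (p t) * indicator {0..} t + ennreal k * (ennreal (q t) * indicator {0..} t) \<partial>lebesgue)"
    using nonneg k by (intro nn_integral_cong) (auto simp: indicator_def ennreal_plus ennreal_mult)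
  also have "\<dots> = (\<integral>\<^sup>+t. ennreal (p t) * indicator {0..} t \<partial>lebesgue)
      + ennreal k * (\<integral>\<^sup>+t. ennreal (q t) * indicator {0..} t \<partial>lebesgue)"
    by (simp add: nn_integral_add nn_integral_cmult meas[OF p] meas[OF q] borel_measurable_times_ennreal)
  finally show ?thesis unfolding nn_integral_completion .
qed

section \<open>Integrated bounds for service and movement\<close>

text \<open>The potential is minus the Bregman divergence \<open>F\<close>. As \<open>F\<close>
  starts at 0 and stays nonnegative, the potential never exceeds its initial value and the additive
  constant is 0.\<close>

lemma service_cost_bound:
  assumes S: "setting n w \<eta> \<delta> c x y"
  shows "service_cost n c x \<le> service_cost n c y + ennreal (2 * ln (1/\<delta>) / \<eta>) * movement_cost n w y"
proof -
  have par: "\<And>i. i < n \<Longrightarrow> 0 < w i" "0 < \<eta>" "0 < \<delta>" "\<delta> \<le> 1/2"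
    "\<And>t i. 0 \<le> t \<Longrightarrow> i < n \<Longrightarrow> 0 \<le> c t i" "\<And>t. 0 \<le> t \<Longrightarrow> in_simplex n (x t)" "\<And>t. 0 \<le> t \<Longrightarrow> in_simplex n (y t)"
    "\<And>i. i < n \<Longrightarrow> y 0 i = x 0 i"
    "\<And>i T. i < n \<Longrightarrow> abs_cont_on {0..T} (\<lambda>t. x t i)" "\<And>i T. i < n \<Longrightarrow> abs_cont_on {0..T} (\<lambda>t. y t i)"
    using S unfolding setting_def emd_path_def abs_cont_path_def by auto
  have box: "0 \<le> x t i" "x t i \<le> 1" "0 \<le> y t i" "y t i \<le> 1" if "0 \<le> t" "i < n" for t i
    using par(6,7)[OF that(1)] that(2) in_simplex_le_1 by (auto simp: in_simplex_def)
  obtain N \<mu> \<xi> where N: "negligible N"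
    and dx: "\<And>t i. t \<in> {0..} - N \<Longrightarrow> i < n \<Longrightarrow> ((\<lambda>s. x s i) has_real_derivative
        (\<eta> / w i * (x t i + \<delta>) * (\<mu> t - c t i + \<xi> t i))) (at t)"
    and dy: "\<And>t i. t \<in> {0..} - N \<Longrightarrow> i < n \<Longrightarrow> (\<lambda>s. y s i) differentiable (at t)"
    and \<xi>: "\<And>t i. 0 \<le> t \<Longrightarrow> i < n \<Longrightarrow> 0 \<le> \<xi> t i \<and> (0 < \<xi> t i \<longrightarrow> x t i = 0)"
    using setting_regular_points[OF S] by metis
  have ln0: "0 \<le> ln (1/\<delta>)" using par(3,4) by simp
  define x' where "x' t i = \<eta> / w i * (x t i + \<delta>) * (\<mu> t - c t i + \<xi> t i)" for t i
  \<comment> \<open>\<open>F\<close> is the divergence of the regularizer at \<open>y\<close>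
    relative to \<open>x\<close>. The linear term need not sum to 0 because of the weights, and it
    makes each summand nonnegative.\<close>
  define F where "F t = (\<Sum>i<n. w i / \<eta> * ((y t i + \<delta>) * (ln (y t i + \<delta>) - ln (x t i + \<delta>)) - (y t i - x t i)))" for t
  define F' where "F' t = (\<Sum>i<n. w i / \<eta> * (deriv (\<lambda>s. y s i) t * (ln (y t i + \<delta>) - ln (x t i + \<delta>))
    + x' t i * (x t i - y t i) / (x t i + \<delta>)))" for t
  let ?q = "\<lambda>t. (\<Sum>i<n. c t i * y t i) + 2 * ln (1/\<delta>) / \<eta> * wnorm n w (\<lambda>i. deriv (\<lambda>s. y s i) t)"
  have wn: "0 \<le> wnorm n w z" for z
    unfolding wnorm_def using par(1) by (intro sum_nonneg mult_nonneg_nonneg) (auto intro: less_imp_le)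
  have cy: "0 \<le> (\<Sum>i<n. c t i * y t i)" "0 \<le> (\<Sum>i<n. c t i * x t i)" if "0 \<le> t" for t
    using par(5) box that by (auto intro!: sum_nonneg)
  have k: "0 \<le> 2 * ln (1/\<delta>) / \<eta>" using ln0 par(2) by simp
  have AC: "abs_cont_on {0..T} F" for T
    unfolding F_def
  proof (intro abs_cont_on_sum abs_cont_on_cmult abs_cont_on_diff)
    fix i assume "i \<in> {..<n}"
    then have i: "i < n" by simp
    show "abs_cont_on {0..T} (\<lambda>t. (y t i + \<delta>) * (ln (y t i + \<delta>) - ln (x t i + \<delta>)))"
    \<comment> \<open>One constant bounds both factors: the first is at most 2, the second at most
      \<open>2 * ln (1/\<delta>)\<close>.\<close>
    proof (rule abs_cont_on_mult[where B = "2 + 2 * ln (1/\<delta>)"])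
      show "abs_cont_on {0..T} (\<lambda>t. y t i + \<delta>)"
        by (intro abs_cont_on_add abs_cont_on_const par(10) i)
      show "abs_cont_on {0..T} (\<lambda>t. ln (y t i + \<delta>) - ln (x t i + \<delta>))"
        using box i by (intro abs_cont_on_diff abs_cont_on_ln_shift par(3,9,10)) auto
      fix t assume "t \<in> {0..T}"
      then have b: "0 \<le> x t i" "x t i \<le> 1" "0 \<le> y t i" "y t i \<le> 1" using box i by auto
      then show "\<bar>y t i + \<delta>\<bar> \<le> 2 + 2 * ln (1/\<delta>)" using par(3,4) ln0 by linarith
      show "\<bar>ln (y t i + \<delta>) - ln (x t i + \<delta>)\<bar> \<le> 2 + 2 * ln (1/\<delta>)"
        using ln_shift_diff_le[OF par(3,4), of "y t i" "x t i"] ln_shift_diff_le[OF par(3,4), of "x t i" "y t i"] b by linarith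
    qed
  qed (use par(9,10) in auto)
  have "(\<integral>\<^sup>+t. ennreal (\<Sum>i<n. c t i * x t i) * indicator {0..} t \<partial>lborel)
    \<le> (\<integral>\<^sup>+t. ennreal (?q t) * indicator {0..} t \<partial>lborel) + ennreal 0"
  proof (rule nn_integral_le_potential[where G = "\<lambda>t. - F t" and G' = "\<lambda>t. - F' t", OF _ _ _ _ _ N])
    show "(\<lambda>t. \<Sum>i<n. c t i * x t i) \<in> borel_measurable (lebesgue_on {0..})"
      by (rule setting_measurable(1)[OF S])
    show "?q \<in> borel_measurable (lebesgue_on {0..})"
      by (intro borel_measurable_add borel_measurable_times borel_measurable_const setting_measurable(2,4)[OF S])
    show "0 \<le> (\<Sum>i<n. c t i * x t i)" if "0 \<le> t" for t using cy(2)[OF that] .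
    show "0 \<le> ?q t" if "0 \<le> t" for t
      using cy(1)[OF that] mult_nonneg_nonneg[OF k wn] by (rule add_nonneg_nonneg)
    show "abs_cont_on {0..T} (\<lambda>t. - F t)" for T
      using abs_cont_on_cmult[OF AC[of T], of "-1"] by simp
    show "((\<lambda>t. - F t) has_real_derivative - F' t) (at t)" if t: "t \<in> {0..} - N" for t
      unfolding F_def F'_def
    proof (rule DERIV_minus, rule DERIV_sum, rule DERIV_cmult, rule bregman_term_deriv)
      fix i assume "i \<in> {..<n}"
      then have i: "i < n" by simp
      show "((\<lambda>s. x s i) has_real_derivative x' t i) (at t)" unfolding x'_def by (rule dx[OF t i])
      show "((\<lambda>s. y s i) has_real_derivative deriv (\<lambda>s. y s i) t) (at t)"
        using dy[OF t i] by (simp add: DERIV_deriv_iff_real_differentiable)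
      show "0 < x t i + \<delta>" "0 < y t i + \<delta>" using box[of t i] t i par(3) by auto
    qed
    show "(\<Sum>i<n. c t i * x t i) \<le> ?q t + - F' t" if t: "t \<in> {0..} - N" for t
      unfolding F'_def
      using service_rate_bound[OF par(6)[of t] par(7)[of t] par(1-4), where X' = "x' t" and \<mu> = "\<mu> t" and c = "c t"
          and \<xi> = "\<xi> t" and Y' = "\<lambda>i. deriv (\<lambda>s. y s i) t"] t \<xi>[of t] by (simp add: x'_def)
    show "- F T - - F 0 \<le> 0" if T: "0 \<le> T" for T
    proof -
      have "F 0 = 0" using par(8) by (simp add: F_def)
      moreover have "0 \<le> F T"
        unfolding F_def
      proof (rule sum_nonneg)
        fix i assume "i \<in> {..<n}"
        then have i: "i < n" by simp
        have "0 \<le> (y T i + \<delta>) * (ln (y T i + \<delta>) - ln (x T i + \<delta>)) - ((y T i + \<delta>) - (x T i + \<delta>))"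
          using box[OF T i] par(3) by (intro bregman_term_nonneg) auto
        then show "0 \<le> w i / \<eta> * ((y T i + \<delta>) * (ln (y T i + \<delta>) - ln (x T i + \<delta>)) - (y T i - x T i))"
          using par(1)[OF i] par(2) by (intro mult_nonneg_nonneg) auto
      qed
      ultimately show ?thesis by simp
    qed
  qed
  also have "\<dots> = service_cost n c y + ennreal (2 * ln (1/\<delta>) / \<eta>) * movement_cost n w y"
    using nn_integral_halfline_add_cmult[OF setting_measurable(2,4)[OF S] cy(1) wn k]
    by (simp add: service_cost_def movement_cost_def)
  finally show ?thesis by (simp add: service_cost_def)
qed

text \<open>Off the null set, conservation of mass and nonnegativity of the coordinates supply the
  hypotheses of the rate bound, and \<xi> vanishes on the support. The total increment of the
  potential \<open>G\<close> gives the additive constant.\<close>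

lemma movement_cost_bound:
  assumes S: "setting n w \<eta> \<delta> c x y"
  shows "movement_cost n w x \<le> ennreal (2 * \<eta> * (1 + \<delta> * real n)) * service_cost n c x
                + ennreal ((1 + 8 * \<delta> * real n * ln (1/\<delta>)) * Max (w ` {..<n}))"
proof -
  have par: "\<And>i. i < n \<Longrightarrow> 0 < w i" "0 < \<eta>" "0 < \<delta>" "\<delta> \<le> 1/2"
    "\<And>t i. 0 \<le> t \<Longrightarrow> i < n \<Longrightarrow> 0 \<le> c t i" "\<And>t. 0 \<le> t \<Longrightarrow> in_simplex n (x t)" "0 < n"
    "\<And>i T. i < n \<Longrightarrow> abs_cont_on {0..T} (\<lambda>t. x t i)"
    using S unfolding setting_def emd_path_def abs_cont_path_def by auto
  have box: "0 \<le> x t i" if "0 \<le> t" "i < n" for t i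
    using par(6)[OF that(1)] that(2) by (auto simp: in_simplex_def)
  obtain N \<mu> \<xi> where N: "negligible N" "0 \<in> N"
    and dx: "\<And>t i. t \<in> {0..} - N \<Longrightarrow> i < n \<Longrightarrow> ((\<lambda>s. x s i) has_real_derivative
        (\<eta> / w i * (x t i + \<delta>) * (\<mu> t - c t i + \<xi> t i))) (at t)"
    and \<xi>: "\<And>t i. 0 \<le> t \<Longrightarrow> i < n \<Longrightarrow> 0 \<le> \<xi> t i \<and> (0 < \<xi> t i \<longrightarrow> x t i = 0)"
    using setting_regular_points[OF S] by metis
  define x' where "x' t i = deriv (\<lambda>s. x s i) t" for t i
  have x': "((\<lambda>s. x s i) has_real_derivative x' t i) (at t)"
      "x' t i = \<eta> / w i * (x t i + \<delta>) * (\<mu> t - c t i + \<xi> t i)"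
    if "t \<in> {0..} - N" "i < n" for t i
    using dx[OF that] DERIV_imp_deriv[OF dx[OF that]] by (simp_all add: x'_def)
  have pos: "0 < t" if "t \<in> {0..} - N" for t using that N(2) by (cases "t = 0") auto
  have sum0: "(\<Sum>i<n. x' t i) = 0" if t: "t \<in> {0..} - N" for t
  proof -
    have "((\<lambda>s. \<Sum>i<n. x s i) has_real_derivative (\<Sum>i<n. x' t i)) (at t)"
      using x'(1)[OF t] by (intro DERIV_sum) auto
    moreover have "((\<lambda>s. \<Sum>i<n. x s i) has_real_derivative 0) (at t)"
    proof (rule has_field_derivative_transform_within_open[where S = "{0<..}"])
      show "((\<lambda>s. 1) has_real_derivative 0) (at t)" by simp
    qed (use pos[OF t] par(6) in \<open>auto simp: in_simplex_def\<close>)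
    ultimately show ?thesis by (rule DERIV_unique)
  qed
  \<comment> \<open>A vanishing coordinate at a positive time is a local minimum.\<close>
  have zero: "x' t i = 0" if t: "t \<in> {0..} - N" and i: "i < n" and z: "x t i = 0" for t i
  proof (rule DERIV_local_min[OF x'(1)[OF t i] pos[OF t]])
    show "\<forall>s. \<bar>t - s\<bar> < t \<longrightarrow> x t i \<le> x s i"
      using box i z by auto
  qed
  define G where "G t = (\<Sum>i<n. w i * ((1 + 2 * \<delta> * real n) * x t i - 2 * \<delta> * (1 + \<delta> * real n) * ln (x t i + \<delta>)))" for t
  define G' where "G' t = (\<Sum>i<n. w i * ((1 + 2 * \<delta> * real n) * x' t i - 2 * \<delta> * (1 + \<delta> * real n) * (x' t i / (x t i + \<delta>))))" for t
  let ?k = "2 * \<eta> * (1 + \<delta> * real n)" and ?C = "(1 + 8 * \<delta> * real n * ln (1/\<delta>)) * Max (w ` {..<n})"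
  have k: "0 \<le> ?k" using par(2,3) by simp
  have cx: "0 \<le> (\<Sum>i<n. c t i * x t i)" if "0 \<le> t" for t
    using par(5) box that by (auto intro!: sum_nonneg)
  \<comment> \<open>The form \<open>0 + ?k * ...\<close> matches the linearity lemma with first
    function 0.\<close>
  have "(\<integral>\<^sup>+t. ennreal (wnorm n w (x' t)) * indicator {0..} t \<partial>lborel)
    \<le> (\<integral>\<^sup>+t. ennreal (0 + ?k * (\<Sum>i<n. c t i * x t i)) * indicator {0..} t \<partial>lborel) + ennreal ?C"
  proof (rule nn_integral_le_potential[where G = G and G' = G', OF _ _ _ _ _ N(1)])
    show "(\<lambda>t. wnorm n w (x' t)) \<in> borel_measurable (lebesgue_on {0..})"
      unfolding x'_def by (rule setting_measurable(3)[OF S])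
    show "(\<lambda>t. 0 + ?k * (\<Sum>i<n. c t i * x t i)) \<in> borel_measurable (lebesgue_on {0..})"
      by (intro borel_measurable_add borel_measurable_times borel_measurable_const setting_measurable(1)[OF S])
    show "0 \<le> wnorm n w (x' t)" for t
      unfolding wnorm_def using par(1) by (intro sum_nonneg mult_nonneg_nonneg) (auto intro: less_imp_le)
    show "0 \<le> 0 + ?k * (\<Sum>i<n. c t i * x t i)" if "0 \<le> t" for t
      using mult_nonneg_nonneg[OF k cx[OF that]] by simp
    show "abs_cont_on {0..T} G" for T
      unfolding G_def using par(8) box
      by (intro abs_cont_on_sum abs_cont_on_cmult abs_cont_on_diff abs_cont_on_ln_shift par(3)) auto
    show "(G has_real_derivative G' t) (at t)" if t: "t \<in> {0..} - N" for t
      unfolding G_def G'_def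
    proof (rule DERIV_sum, rule DERIV_cmult, rule DERIV_diff; rule DERIV_cmult)
      fix i assume "i \<in> {..<n}"
      then have i: "i < n" by simp
      show "((\<lambda>s. x s i) has_real_derivative x' t i) (at t)" by (rule x'(1)[OF t i])
      have "0 < x t i + \<delta>" using box[of t i] t i par(3) by auto
      then show "((\<lambda>s. ln (x s i + \<delta>)) has_real_derivative x' t i / (x t i + \<delta>)) (at t)"
        using DERIV_chain2[OF DERIV_ln_divide DERIV_add[OF x'(1)[OF t i] DERIV_const[of \<delta>]]] by simp
    qed
    show "wnorm n w (x' t) \<le> 0 + ?k * (\<Sum>i<n. c t i * x t i) + G' t" if t: "t \<in> {0..} - N" for t
    proof -
      have t0: "0 \<le> t" using t by simp
      have "x' t i = \<eta> / w i * (x t i + \<delta>) * (\<mu> t - c t i)" if "i < n" "0 < x t i" for i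
      proof -
        have "\<xi> t i = 0" using \<xi>[OF t0 that(1)] that(2) by force
        then show ?thesis using x'(2)[OF t that(1)] by simp
      qed
      then show ?thesis
        unfolding G'_def add_0
        by (intro movement_rate_bound[OF par(6)[OF t0] par(1-3) par(5)[OF t0] sum0[OF t] zero[OF t]])
    qed
    show "G T - G 0 \<le> ?C" if T: "0 \<le> T" for T
      unfolding G_def
      by (rule movement_potential_bound[OF par(6)[OF T] par(6)[OF order_refl] par(7) par(1,3,4)])
  qed
  also have "(\<integral>\<^sup>+t. ennreal (0 + ?k * (\<Sum>i<n. c t i * x t i)) * indicator {0..} t \<partial>lborel)
    = ennreal ?k * service_cost n c x"
    using nn_integral_halfline_add_cmult[of "\<lambda>_. 0", OF _ setting_measurable(1)[OF S] _ cx k]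
    by (simp add: service_cost_def)
  finally show ?thesis by (simp add: movement_cost_def x'_def)
qed

section \<open>General bounds and the choice of parameters\<close>

theorem theorem4:
  shows "(\<forall>n w \<eta> \<delta> c x y. setting n w \<eta> \<delta> c x y \<longrightarrow>
            service_cost n c x
              \<le> service_cost n c y + ennreal (2 * ln (1/\<delta>) / \<eta>) * movement_cost n w y
          \<and> movement_cost n w x
              \<le> ennreal (2 * \<eta> * (1 + \<delta> * real n)) * service_cost n c x
                + ennreal ((1 + 8 * \<delta> * real n * ln (1/\<delta>)) * Max (w ` {..<n})))
       \<and> (\<exists>K::real. \<forall>n w c x y.
            setting n w (4 * ln (real n)) (1 / (real n)^2) c x y \<longrightarrow>
              service_cost n c x \<le> service_cost n c y + movement_cost n w y
            \<and> movement_cost n w x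
                \<le> ennreal (K * ln (real n)) *
                   (service_cost n c y + movement_cost n w y + ennreal (Max (w ` {..<n}))))"
\<comment> \<open>The constant comes from \<open>8 * (1 + 1/n) \<le> 12\<close> for
  \<open>n \<ge> 2\<close>; it also suffices for the additive term.\<close>
proof (intro conjI allI impI exI[of _ 12])
  fix n w \<eta> \<delta> c x y assume S: "setting n w \<eta> \<delta> c x y"
  show "service_cost n c x \<le> service_cost n c y + ennreal (2 * ln (1/\<delta>) / \<eta>) * movement_cost n w y"
    by (rule service_cost_bound[OF S])
  show "movement_cost n w x \<le> ennreal (2 * \<eta> * (1 + \<delta> * real n)) * service_cost n c x
                + ennreal ((1 + 8 * \<delta> * real n * ln (1/\<delta>)) * Max (w ` {..<n}))"
    by (rule movement_cost_bound[OF S])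
next
  fix n :: nat and w :: "nat \<Rightarrow> real" and c x y
  let ?L = "ln (real n)" and ?W = "Max (w ` {..<n})"
  assume S: "setting n w (4 * ln (real n)) (1 / (real n)^2) c x y"
  then have n: "2 \<le> n" and w: "\<And>i. i < n \<Longrightarrow> 0 < w i" by (auto simp: setting_def)
  \<comment> \<open>A positive lower bound for the logarithm of \<open>n\<close> lets the additive 1
    in the coefficient of the maximal weight be absorbed.\<close>
  have "1/2 \<le> ln (2::real)" using ln_le_minus_one[of "1/2::real"] by (simp add: ln_div)
  also have "\<dots> \<le> ?L" using n by (intro ln_mono) auto
  finally have L: "1/2 \<le> ?L" .
  have "w 0 \<le> ?W" using n by (intro Max_ge) auto
  moreover have "0 < w 0" using w n by simp
  ultimately have W: "0 \<le> ?W" by linarith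
  have lnd: "ln (1 / (1 / (real n)\<^sup>2)) = 2 * ?L" using n by (simp add: ln_realpow)
  \<comment> \<open>These parameters make the coefficient of the movement of \<open>y\<close>
    exactly 1.\<close>
  have "2 * ln (1 / (1 / (real n)\<^sup>2)) / (4 * ?L) = 1" unfolding lnd using L by simp
  then show srv: "service_cost n c x \<le> service_cost n c y + movement_cost n w y"
    using service_cost_bound[OF S] by simp
  have dn: "1 / (real n)\<^sup>2 * real n = 1 / real n" using n by (simp add: power2_eq_square)
  have inv: "1 / real n \<le> 1/2" using n by (simp add: field_simps)
  have 1: "2 * (4 * ?L) * (1 + 1 / (real n)\<^sup>2 * real n) \<le> 12 * ?L"
  proof -
    have "8 * ?L * (1 + 1 / real n) \<le> 8 * ?L * (1 + 1/2)" using L inv by (intro mult_left_mono) auto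
    then show ?thesis unfolding dn by simp
  qed
  have 2: "(1 + 8 * (1 / (real n)\<^sup>2) * real n * ln (1 / (1 / (real n)\<^sup>2))) * ?W \<le> 12 * ?L * ?W"
  proof (rule mult_right_mono[OF _ W])
    have "8 * (1 / real n) * (2 * ?L) \<le> 8 * (1/2) * (2 * ?L)" using L inv by (intro mult_right_mono mult_left_mono) auto
    then show "1 + 8 * (1 / (real n)\<^sup>2) * real n * ln (1 / (1 / (real n)\<^sup>2)) \<le> 12 * ?L"
      unfolding lnd mult.assoc[of 8] dn using L by simp
  qed
  have "movement_cost n w x \<le> ennreal (2 * (4 * ?L) * (1 + 1 / (real n)\<^sup>2 * real n)) * service_cost n c x
      + ennreal ((1 + 8 * (1 / (real n)\<^sup>2) * real n * ln (1 / (1 / (real n)\<^sup>2))) * ?W)"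
    by (rule movement_cost_bound[OF S])
  also have "\<dots> \<le> ennreal (12 * ?L) * (service_cost n c y + movement_cost n w y) + ennreal (12 * ?L * ?W)"
    using srv by (intro add_mono mult_mono ennreal_leI 1 2) auto
  also have "\<dots> = ennreal (12 * ?L) * (service_cost n c y + movement_cost n w y + ennreal ?W)"
    using L W by (simp add: ennreal_mult distrib_left)
  finally show "movement_cost n w x \<le> ennreal (12 * ?L) * (service_cost n c y + movement_cost n w y + ennreal ?W)" .
qed

end
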